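(* Let $k<0$ and $m>0$ be integers. Then $J_k^m$ is a finite-dimensional $\mathbb{C}$-vector space.
   Context: $\mathfrak{H}$ is the upper half-plane, $e(x)=\exp(2\pi ix)$, $q=e(\tau)$, $\zeta=e(z)$. For a lattice $L=[\omega_1,\omega_2]$, $\eta(\omega,L)$ for $\omega\in L$ is the quasi-period of the Weierstrass $\zeta$-function ($\zeta(z+\omega,L)=\zeta(z,L)+\eta(\omega,L)$), extended $\mathbb{R}$-linearly. $\psi(z,L)=-1$ if $z\in L-2L$, $1$ otherwise; $\psi(\lambda\ \mu):=\psi(\lambda\tau+\mu,[\tau,1])$. For integer $k$: $(\phi|'_kM)(\tau,z)=(c\tau+d)^{-k}\phi(\frac{a\tau+b}{c\tau+d},\frac{z}{c\tau+d})$ for $M=\begin{pmatrix}a&b\\c&d\end{pmatrix}$, and $(\phi|''_k[\lambda\ \mu])(\tau,z)=\big(\psi(\lambda\ \mu)\exp(\eta(\lambda\tau+\mu,[\tau,1])(z+\tfrac12(\lambda\tau+\mu)))\big)^k\phi(\tau,z+\lambda\tau+\mu)$. $\rho(\tau,z)=\exp(\tfrac12\eta(1,[\tau,1])z^2-\pi iz)$. $J_k:=J_k(\mathrm{SL}_2(\mathbb{Z}))$ is the space of holomorphic $\phi:\mathfrak{H}\times\mathbb{C}\to\mathbb{C}$ with (i) $\phi|'_kM=\phi$ for $M\in\mathrm{SL}_2(\mathbb{Z})$; (ii) $\phi|''_kX=\phi$ for $X\in\mathbb{Z}^2$; (iii) for each $M\in\mathrm{SL}_2(\mathbb{Z})$,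 $\rho^k(\phi|'_kM)=\sum_{n\ge0}\sum_{|r|\le r_0(n)}c(n,r)q^n\zeta^r$ for some increasing sequence of nonnegative integers $r_0(n)$ with $r_0(n)/n\to0$. For an integer $m>0$, $J_k^m$ is the subspace of $\phi\in J_k$ for which $\rho^k\phi=\sum_{n\ge0}\sum_{|r|\le r_0(n)}c(n,r)q^n\zeta^r$ (with $r_0$ as in (iii)) and $\min\{n-r_0(n):n\ge0\}+\frac{k}{8}\ge -m$.
   Formalization: The zero function is put into J_k^m explicitly: for k < -8m no function satisfies the inequality min{n-r_0(n)}+k/8 >= -m, so the set as literally defined would be empty; for k >= -8m nothing changes. "Increasing" r_0 is read as non-decreasing. *)

theory Defs
  imports "HOL-Analysis.Analysis" "HOL-Library.Function_Algebras"
begin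

definition e :: "complex \<Rightarrow> complex" where
  "e x = exp (2 * of_real pi * \<i> * x)"

definition upper_half_plane :: "complex set" where
  "upper_half_plane = {\<tau>. Im \<tau> > 0}"

definition lattice :: "complex \<Rightarrow> complex \<Rightarrow> complex set" where
  "lattice \<omega>1 \<omega>2 = {of_int a * \<omega>1 + of_int b * \<omega>2 | a b :: int. True}"

definition weierstrass_zeta :: "complex \<Rightarrow> complex set \<Rightarrow> complex" where
  "weierstrass_zeta z L = 1 / z + (\<Sum>\<^sub>\<infinity>\<omega>\<in>L - {0}. 1 / (z - \<omega>) + 1 / \<omega> + z / \<omega>\<^sup>2)"

text \<open>The quasi-period map, together with its extension from \<open>L\<close> to \<open>\<complex>\<close>: \<^const>\<open>linear\<close> is
  linearity over the reals, and a lattice spans \<open>\<complex>\<close> over the reals, so the map is unique.\<close>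

definition eta :: "complex \<Rightarrow> complex set \<Rightarrow> complex" where
  "eta w L = (THE f. linear f \<and>
     (\<forall>\<omega>\<in>L. \<forall>z. z \<notin> L \<longrightarrow> weierstrass_zeta (z + \<omega>) L = weierstrass_zeta z L + f \<omega>)) w"

definition psi :: "complex \<Rightarrow> complex set \<Rightarrow> complex" where
  "psi z L = (if z \<in> L - (\<lambda>w. 2 * w) ` L then - 1 else 1)"

definition SL2Z :: "(int^2^2) set" where
  "SL2Z = {M. det M = 1}"

definition slash_mat :: "(complex \<times> complex \<Rightarrow> complex) \<Rightarrow> int \<Rightarrow> int^2^2 \<Rightarrow> complex \<times> complex \<Rightarrow> complex" where
  "slash_mat \<phi> k M = (\<lambda>(\<tau>, z).
     let a = of_int (M $ 1 $ 1); b = of_int (M $ 1 $ 2);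
         c = of_int (M $ 2 $ 1); d = of_int (M $ 2 $ 2)
     in (c * \<tau> + d) powi (- k) * \<phi> ((a * \<tau> + b) / (c * \<tau> + d), z / (c * \<tau> + d)))"

definition slash_vec :: "(complex \<times> complex \<Rightarrow> complex) \<Rightarrow> int \<Rightarrow> int \<times> int \<Rightarrow> complex \<times> complex \<Rightarrow> complex" where
  "slash_vec \<phi> k X = (\<lambda>(\<tau>, z).
     let \<omega> = of_int (fst X) * \<tau> + of_int (snd X); L = lattice \<tau> 1
     in (psi \<omega> L * exp (eta \<omega> L * (z + \<omega> / 2))) powi k * \<phi> (\<tau>, z + \<omega>))"

definition rho :: "complex \<Rightarrow> complex \<Rightarrow> complex" where
  "rho \<tau> z = exp (eta 1 (lattice \<tau> 1) * z\<^sup>2 / 2 - of_real pi * \<i> * z)"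

text \<open>Holomorphy in two variables: complex differentiability at every point.\<close>

definition holomorphic2_on :: "(complex \<times> complex \<Rightarrow> complex) \<Rightarrow> (complex \<times> complex) set \<Rightarrow> bool" where
  "holomorphic2_on f S \<longleftrightarrow>
     (\<forall>p\<in>S. \<exists>a b. (f has_derivative (\<lambda>h. a * fst h + b * snd h)) (at p within S))"

text \<open>``Increasing'' has to be read as non-decreasing: a strictly increasing sequence of
  natural numbers satisfies \<open>r0 n \<ge> n\<close>.\<close>

definition admissible :: "(nat \<Rightarrow> nat) \<Rightarrow> bool" where
  "admissible r0 \<longleftrightarrow> incseq r0 \<and> (\<lambda>n. real (r0 n) / real n) \<longlonglongrightarrow> 0"

definition has_expansion :: "int \<Rightarrow> (complex \<times> complex \<Rightarrow> complex) \<Rightarrow> (nat \<Rightarrow> nat) \<Rightarrow> bool" where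
  "has_expansion k f r0 \<longleftrightarrow> (\<exists>c :: nat \<Rightarrow> int \<Rightarrow> complex. \<forall>\<tau>\<in>upper_half_plane. \<forall>z.
     (\<lambda>n. \<Sum>r = - int (r0 n)..int (r0 n). c n r * e \<tau> ^ n * e z powi r)
       sums (rho \<tau> z powi k * f (\<tau>, z)))"

text \<open>Functions on the product of the upper half-plane and \<open>\<complex>\<close> are represented by total functions
  that vanish off this set, so that equality of functions is equality on the domain.\<close>

definition J_space :: "int \<Rightarrow> (complex \<times> complex \<Rightarrow> complex) set" where
  "J_space k = {\<phi>.
     (\<forall>p. p \<notin> upper_half_plane \<times> UNIV \<longrightarrow> \<phi> p = 0) \<and>
     holomorphic2_on \<phi> (upper_half_plane \<times> UNIV) \<and>
     (\<forall>M\<in>SL2Z. \<forall>p\<in>upper_half_plane \<times> UNIV. slash_mat \<phi> k M p = \<phi> p) \<and>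
     (\<forall>X. \<forall>p\<in>upper_half_plane \<times> UNIV. slash_vec \<phi> k X p = \<phi> p) \<and>
     (\<forall>M\<in>SL2Z. \<exists>r0. admissible r0 \<and> has_expansion k (slash_mat \<phi> k M) r0)}"

text \<open>The infimum below is attained. The zero function is included
  explicitly: every \<open>r0\<close> gives a minimum \<open>\<le> 0\<close>, so for \<open>k < - 8 * m\<close> no function at all satisfies
  the inequality, and the subspace meant is then \<open>{0}\<close>. For \<open>k \<ge> - 8 * m\<close> the zero
  function satisfies it with \<open>r0 = 0\<close>, and the disjunct changes nothing.\<close>

definition J_space_bounded :: "int \<Rightarrow> int \<Rightarrow> (complex \<times> complex \<Rightarrow> complex) set" where
  "J_space_bounded k m = {\<phi> \<in> J_space k. \<phi> = 0 \<or>
     (\<exists>r0. admissible r0 \<and> has_expansion k \<phi> r0 \<and>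
        real_of_int (INF n. int n - int (r0 n)) + real_of_int k / 8 \<ge> - real_of_int m)}"

lemma admissible_INF_attained:
  assumes "admissible r0"
  shows "bdd_below (range (\<lambda>n. int n - int (r0 n)))"
    and "(INF n. int n - int (r0 n)) \<in> range (\<lambda>n. int n - int (r0 n))"
proof -
  have "eventually (\<lambda>n. real (r0 n) / real n < 1) sequentially"
    using assms unfolding admissible_def by (auto intro: order_tendstoD(2)[where a = 1])
  then obtain N where N: "\<And>n. n \<ge> N \<Longrightarrow> real (r0 n) / real n < 1"
    by (auto simp: eventually_sequentially)
  have "int n - int (r0 n) \<ge> - int (r0 N)" for n
  proof (cases "n \<ge> Suc N")
    case True
    then have "real (r0 n) < real n"
      using N[of n] by (simp add: divide_simps)
    then show ?thesis by simp
  next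
    case False
    then have "r0 n \<le> r0 N"
      using assms by (auto simp: admissible_def intro: incseqD)
    then show ?thesis by simp
  qed
  then show bdd: "bdd_below (range (\<lambda>n. int n - int (r0 n)))"
    by (intro bdd_belowI2)
  let ?X = "range (\<lambda>n. int n - int (r0 n))"
  obtain x where x: "x \<in> ?X" "x < Inf ?X + 1"
    using cInf_lessD[of ?X "Inf ?X + 1"] by auto
  moreover have "Inf ?X \<le> x"
    using x bdd by (intro cInf_lower)
  ultimately show "Inf ?X \<in> ?X"
    by (metis zle_add1_eq_le order_antisym)
qed

definition fun_scale :: "complex \<Rightarrow> ('a \<Rightarrow> complex) \<Rightarrow> 'a \<Rightarrow> complex" where
  "fun_scale c f = (\<lambda>x. c * f x)"

global_interpretation cfun: vector_space "fun_scale :: complex \<Rightarrow> ('a \<Rightarrow> complex) \<Rightarrow> 'a \<Rightarrow> complex"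
  by unfold_locales (auto simp: fun_scale_def algebra_simps)

end

theory Submission
  imports Defs "HOL-Complex_Analysis.Complex_Analysis"
begin

text \<open>Put \<open>K = - k > 0\<close>. For fixed \<open>\<tau>\<close>, the function \<open>\<phi>(\<tau>, \<cdot>)\<close> is quasi-periodic exactly like the \<open>K\<close>-th power of the
  Weierstrass function \<open>\<sigma>\<close> of \<open>[\<tau>, 1]\<close>, which has simple zeros precisely at the lattice points. So if \<open>\<phi>(\<tau>, \<cdot>)\<close>
  vanishes to order at least \<open>K\<close> at \<open>0\<close>, then \<open>\<phi>(\<tau>, \<cdot>) / \<sigma>\<^sup>K\<close> is an entire elliptic function, hence constant, and
  \<open>\<phi>(\<tau>, \<cdot>)\<close> is determined by its \<open>K\<close>-th Taylor coefficient at \<open>0\<close>.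

  The \<open>j\<close>-th Taylor coefficient has weight \<open>j - K\<close>, and the square of the first nonvanishing one is a power series
  in \<open>q\<close>, since it is the leading coefficient of \<open>\<rho>\<^sup>k\<phi>(\<tau>, z) \<cdot> \<rho>\<^sup>k\<phi>(\<tau>, \<i>z)\<close>. Modular forms of negative weight are zero
  and those of weight \<open>0\<close> are constant. Hence \<open>\<phi>\<close> does vanish to order at least \<open>K\<close>, and if its \<open>K\<close>-th coefficient
  is zero at one \<open>\<tau>\<close>, then \<open>\<phi> = 0\<close>. The whole space \<open>J\<^sub>k\<close> therefore has dimension at most \<open>1\<close>.\<close>

section \<open>Lattices and elliptic functions\<close>

locale complex_lattice =
  fixes \<omega>\<^sub>1 \<omega>\<^sub>2 :: complex
  assumes independent_periods: "Im (\<omega>\<^sub>1 * cnj \<omega>\<^sub>2) \<noteq> 0"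
begin

abbreviation periods :: "complex set" ("\<Lambda>") where
  "\<Lambda> \<equiv> lattice \<omega>\<^sub>1 \<omega>\<^sub>2"

lemma lattice_iff: "\<omega> \<in> \<Lambda> \<longleftrightarrow> (\<exists>a b::int. \<omega> = of_int a * \<omega>\<^sub>1 + of_int b * \<omega>\<^sub>2)"
  by (simp add: lattice_def)

lemma of_int_combination_in_lattice [simp]: "of_int a * \<omega>\<^sub>1 + of_int b * \<omega>\<^sub>2 \<in> \<Lambda>"
  by (auto simp: lattice_iff)

lemma zero_in_lattice [simp]: "0 \<in> \<Lambda>"
  and period1_in_lattice [simp]: "\<omega>\<^sub>1 \<in> \<Lambda>"
  and period2_in_lattice [simp]: "\<omega>\<^sub>2 \<in> \<Lambda>"
  using of_int_combination_in_lattice[of 0 0] of_int_combination_in_lattice[of 1 0]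
    of_int_combination_in_lattice[of 0 1] by simp_all

lemma lattice_add:
  assumes "x \<in> \<Lambda>" "y \<in> \<Lambda>"
  shows "x + y \<in> \<Lambda>"
proof -
  obtain a b c d :: int
    where "x = of_int a * \<omega>\<^sub>1 + of_int b * \<omega>\<^sub>2" "y = of_int c * \<omega>\<^sub>1 + of_int d * \<omega>\<^sub>2"
    using assms unfolding lattice_iff by blast
  then have "x + y = of_int (a + c) * \<omega>\<^sub>1 + of_int (b + d) * \<omega>\<^sub>2"
    by (simp add: algebra_simps)
  then show ?thesis
    by (simp only: of_int_combination_in_lattice)
qed

lemma lattice_minus:
  assumes "x \<in> \<Lambda>"
  shows "- x \<in> \<Lambda>"
proof -
  obtain a b :: int where "x = of_int a * \<omega>\<^sub>1 + of_int b * \<omega>\<^sub>2"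
    using assms unfolding lattice_iff by blast
  then have "- x = of_int (- a) * \<omega>\<^sub>1 + of_int (- b) * \<omega>\<^sub>2"
    by simp
  then show ?thesis
    by (simp only: of_int_combination_in_lattice)
qed

lemma lattice_diff: "x \<in> \<Lambda> \<Longrightarrow> y \<in> \<Lambda> \<Longrightarrow> x - y \<in> \<Lambda>"
  using lattice_add[of x "- y"] lattice_minus[of y] by simp

lemma lattice_minus_iff [simp]: "- x \<in> \<Lambda> \<longleftrightarrow> x \<in> \<Lambda>"
  using lattice_minus[of x] lattice_minus[of "- x"] by auto

lemma lattice_add_iff [simp]: "y \<in> \<Lambda> \<Longrightarrow> x + y \<in> \<Lambda> \<longleftrightarrow> x \<in> \<Lambda>"
  using lattice_add[of x y] lattice_diff[of "x + y" y] by auto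

lemma lattice_diff_iff [simp]: "y \<in> \<Lambda> \<Longrightarrow> x - y \<in> \<Lambda> \<longleftrightarrow> x \<in> \<Lambda>"
  using lattice_add_iff[of y "x - y"] by simp

definition coord1 :: "complex \<Rightarrow> real" where
  "coord1 z = Im (z * cnj \<omega>\<^sub>2) / Im (\<omega>\<^sub>1 * cnj \<omega>\<^sub>2)"

definition coord2 :: "complex \<Rightarrow> real" where
  "coord2 z = Im (\<omega>\<^sub>1 * cnj z) / Im (\<omega>\<^sub>1 * cnj \<omega>\<^sub>2)"

lemma linear_coord1: "linear coord1" and linear_coord2: "linear coord2"
  by (rule linearI; simp add: coord1_def coord2_def algebra_simps add_divide_distrib diff_divide_distrib)+

lemma coord1_combination [simp]: "coord1 (of_real x * \<omega>\<^sub>1 + of_real y * \<omega>\<^sub>2) = x"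
proof -
  have "Im ((of_real x * \<omega>\<^sub>1 + of_real y * \<omega>\<^sub>2) * cnj \<omega>\<^sub>2) = x * Im (\<omega>\<^sub>1 * cnj \<omega>\<^sub>2)"
    by (simp add: algebra_simps)
  then show ?thesis
    using independent_periods by (simp add: coord1_def)
qed

lemma coord2_combination [simp]: "coord2 (of_real x * \<omega>\<^sub>1 + of_real y * \<omega>\<^sub>2) = y"
proof -
  have "Im (\<omega>\<^sub>1 * cnj (of_real x * \<omega>\<^sub>1 + of_real y * \<omega>\<^sub>2)) = y * Im (\<omega>\<^sub>1 * cnj \<omega>\<^sub>2)"
    by (simp add: algebra_simps)
  then show ?thesis
    using independent_periods by (simp add: coord2_def)
qed

lemma coord1_of_int_combination [simp]: "coord1 (of_int a * \<omega>\<^sub>1 + of_int b * \<omega>\<^sub>2) = of_int a"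
  and coord2_of_int_combination [simp]: "coord2 (of_int a * \<omega>\<^sub>1 + of_int b * \<omega>\<^sub>2) = of_int b"
  using coord1_combination[of "of_int a" "of_int b"] coord2_combination[of "of_int a" "of_int b"]
  by simp_all

lemma coords_eq: "z = of_real (coord1 z) * \<omega>\<^sub>1 + of_real (coord2 z) * \<omega>\<^sub>2"
proof -
  define D u v where "D = Im (\<omega>\<^sub>1 * cnj \<omega>\<^sub>2)" and "u = Im (z * cnj \<omega>\<^sub>2)" and "v = Im (\<omega>\<^sub>1 * cnj z)"
  have "of_real D * z = of_real u * \<omega>\<^sub>1 + of_real v * \<omega>\<^sub>2"
    by (simp add: D_def u_def v_def complex_eq_iff algebra_simps)
  moreover have "D \<noteq> 0"
    using independent_periods by (simp add: D_def)
  ultimately have "z = of_real (u / D) * \<omega>\<^sub>1 + of_real (v / D) * \<omega>\<^sub>2"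
    by (simp add: field_simps)
  then show ?thesis
    by (simp only: coord1_def coord2_def D_def u_def v_def)
qed

lemma coords_bound:
  obtains C where "C > 0" "\<And>z. \<bar>coord1 z\<bar> + \<bar>coord2 z\<bar> \<le> C * norm z"
proof
  let ?D = "\<bar>Im (\<omega>\<^sub>1 * cnj \<omega>\<^sub>2)\<bar>"
  let ?C = "(norm \<omega>\<^sub>1 + norm \<omega>\<^sub>2) / ?D"
  have D: "?D > 0"
    using independent_periods by simp
  have "\<omega>\<^sub>1 \<noteq> 0"
    using independent_periods by auto
  then show "?C > 0"
    using D by (intro divide_pos_pos add_pos_nonneg) auto
  show "\<bar>coord1 z\<bar> + \<bar>coord2 z\<bar> \<le> ?C * norm z" for z
  proof -
    have "\<bar>Im (v * cnj w)\<bar> \<le> norm v * norm w" for v w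
      using abs_Im_le_cmod[of "v * cnj w"] by (simp add: norm_mult)
    from this[of z \<omega>\<^sub>2] this[of \<omega>\<^sub>1 z] have "\<bar>coord1 z\<bar> \<le> norm z * norm \<omega>\<^sub>2 / ?D" "\<bar>coord2 z\<bar> \<le> norm \<omega>\<^sub>1 * norm z / ?D"
      unfolding coord1_def coord2_def abs_divide by (auto intro: divide_right_mono)
    then have "\<bar>coord1 z\<bar> + \<bar>coord2 z\<bar> \<le> norm z * norm \<omega>\<^sub>2 / ?D + norm \<omega>\<^sub>1 * norm z / ?D"
      by (rule add_mono)
    then show ?thesis
      by (simp add: algebra_simps add_divide_distrib)
  qed
qed

lemma lattice_norm_ge:
  obtains d where "d > 0"
    "\<And>a b::int. norm (of_int a * \<omega>\<^sub>1 + of_int b * \<omega>\<^sub>2) \<ge> d * (\<bar>real_of_int a\<bar> + \<bar>real_of_int b\<bar>)"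
proof -
  obtain C where C: "C > 0" "\<And>z. \<bar>coord1 z\<bar> + \<bar>coord2 z\<bar> \<le> C * norm z"
    using coords_bound by blast
  have "\<bar>real_of_int a\<bar> + \<bar>real_of_int b\<bar> \<le> C * norm (of_int a * \<omega>\<^sub>1 + of_int b * \<omega>\<^sub>2)" for a b :: int
    using C(2)[of "of_int a * \<omega>\<^sub>1 + of_int b * \<omega>\<^sub>2"] by simp
  then have "norm (of_int a * \<omega>\<^sub>1 + of_int b * \<omega>\<^sub>2) \<ge> 1 / C * (\<bar>real_of_int a\<bar> + \<bar>real_of_int b\<bar>)" for a b :: int
    using C(1) by (simp add: field_simps)
  then show ?thesis
    using that[of "1 / C"] C(1) by simp
qed

lemma lattice_separated:
  obtains d where "d > 0" "\<And>\<omega>. \<omega> \<in> \<Lambda> \<Longrightarrow> \<omega> \<noteq> 0 \<Longrightarrow> norm \<omega> \<ge> d"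
proof -
  obtain d where d: "d > 0"
    "\<And>a b::int. norm (of_int a * \<omega>\<^sub>1 + of_int b * \<omega>\<^sub>2) \<ge> d * (\<bar>real_of_int a\<bar> + \<bar>real_of_int b\<bar>)"
    using lattice_norm_ge by blast
  have "norm \<omega> \<ge> d" if "\<omega> \<in> \<Lambda>" "\<omega> \<noteq> 0" for \<omega>
  proof -
    obtain a b :: int where \<omega>: "\<omega> = of_int a * \<omega>\<^sub>1 + of_int b * \<omega>\<^sub>2"
      using \<open>\<omega> \<in> \<Lambda>\<close> unfolding lattice_iff by blast
    with \<open>\<omega> \<noteq> 0\<close> have "a \<noteq> 0 \<or> b \<noteq> 0" by auto
    then have "\<bar>a\<bar> + \<bar>b\<bar> \<ge> 1" by linarith
    then have "d * 1 \<le> d * (\<bar>real_of_int a\<bar> + \<bar>real_of_int b\<bar>)"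
      using d(1) by (intro mult_left_mono) linarith+
    with d(2)[of a b] show ?thesis by (simp add: \<omega>)
  qed
  with d(1) that show ?thesis by blast
qed

lemma lattice_sparse: "\<Lambda> sparse_in UNIV"
proof -
  obtain d where d: "d > 0" "\<And>\<omega>. \<omega> \<in> \<Lambda> \<Longrightarrow> \<omega> \<noteq> 0 \<Longrightarrow> norm \<omega> \<ge> d"
    using lattice_separated by blast
  have "x = y" if "x \<in> \<Lambda>" "y \<in> \<Lambda>" "dist y x < d" for x y
    using d(2)[of "y - x"] that lattice_diff[of y x] by (force simp: dist_norm)
  then have "\<not> z islimpt \<Lambda>" for z
    using d(1) by (metis discrete_imp_not_islimpt)
  then show ?thesis
    by (simp add: sparse_in_open)
qed

lemma open_Compl_lattice_subset: "S \<subseteq> \<Lambda> \<Longrightarrow> open (- S)"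
  by (intro open_Compl sparse_in_UNIV_imp_closed sparse_in_subset2[OF lattice_sparse])

lemma open_Compl_lattice: "open (- \<Lambda>)"
  by (rule open_Compl_lattice_subset) simp

lemma eventually_not_in_lattice: "eventually (\<lambda>z. z \<notin> \<Lambda>) (at w)"
  using lattice_sparse by (simp add: sparse_in_eventually_iff)

lemma finite_lattice_cball: "finite (\<Lambda> \<inter> cball 0 R)"
  using sparse_in_compact_finite[OF sparse_in_subset[OF lattice_sparse], of "cball 0 R"]
  by (simp add: Int_commute)

lemma connected_Compl_lattice: "connected (- \<Lambda>)"
proof (intro path_connected_imp_connected path_connected_complement_countable)
  have "\<Lambda> = range (\<lambda>(a, b). of_int a * \<omega>\<^sub>1 + of_int b * \<omega>\<^sub>2)"
    by (auto simp: lattice_def)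
  then show "countable \<Lambda>" by simp
qed simp

lemma lattice_reduce:
  obtains \<omega> where "\<omega> \<in> \<Lambda>" "norm (z - \<omega>) \<le> norm \<omega>\<^sub>1 + norm \<omega>\<^sub>2"
proof
  let ?x = "coord1 z" and ?y = "coord2 z"
  let ?\<omega> = "of_int \<lfloor>?x\<rfloor> * \<omega>\<^sub>1 + of_int \<lfloor>?y\<rfloor> * \<omega>\<^sub>2"
  show "?\<omega> \<in> \<Lambda>" by simp
  have "z - ?\<omega> = of_real (frac ?x) * \<omega>\<^sub>1 + of_real (frac ?y) * \<omega>\<^sub>2"
    by (subst coords_eq[of z]) (simp add: frac_def algebra_simps)
  also have "norm \<dots> \<le> frac ?x * norm \<omega>\<^sub>1 + frac ?y * norm \<omega>\<^sub>2"
    by (rule order.trans[OF norm_triangle_ineq]) (simp add: norm_mult)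
  also have "\<dots> \<le> 1 * norm \<omega>\<^sub>1 + 1 * norm \<omega>\<^sub>2"
    by (intro add_mono mult_right_mono) (auto intro: less_imp_le frac_lt_1)
  finally show "norm (z - ?\<omega>) \<le> norm \<omega>\<^sub>1 + norm \<omega>\<^sub>2" by simp
qed

lemma additive_quasi_period_lattice:
  fixes f :: "complex \<Rightarrow> complex"
  assumes period1: "\<And>z. z \<notin> \<Lambda> \<Longrightarrow> f (z + \<omega>\<^sub>1) = f z + h\<^sub>1"
    and period2: "\<And>z. z \<notin> \<Lambda> \<Longrightarrow> f (z + \<omega>\<^sub>2) = f z + h\<^sub>2"
    and z: "z \<notin> \<Lambda>"
  shows "f (z + (of_int a * \<omega>\<^sub>1 + of_int b * \<omega>\<^sub>2)) = f z + (of_int a * h\<^sub>1 + of_int b * h\<^sub>2)"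
proof -
  have multiple: "f (z + of_int n * \<omega>) = f z + of_int n * h"
    if \<omega>: "\<And>n::int. of_int n * \<omega> \<in> \<Lambda>" and period: "\<And>z. z \<notin> \<Lambda> \<Longrightarrow> f (z + \<omega>) = f z + h"
      and z: "z \<notin> \<Lambda>" for n :: int and \<omega> h z
  proof (induction n rule: int_induct[where k = 0])
    case (step1 i)
    then show ?case using period[of "z + of_int i * \<omega>"] z \<omega>[of i] by (simp add: algebra_simps)
  next
    case (step2 i)
    have "z + of_int (i - 1) * \<omega> \<notin> \<Lambda>"
      using z \<omega>[of "i - 1"] by simp
    from period[OF this] step2 show ?case by (simp add: algebra_simps)
  qed simp
  have \<omega>\<^sub>1: "of_int n * \<omega>\<^sub>1 \<in> \<Lambda>" and \<omega>\<^sub>2: "of_int n * \<omega>\<^sub>2 \<in> \<Lambda>" for n :: int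
    using of_int_combination_in_lattice[of n 0] of_int_combination_in_lattice[of 0 n] by simp_all
  have "f (z + of_int a * \<omega>\<^sub>1 + of_int b * \<omega>\<^sub>2) = f (z + of_int a * \<omega>\<^sub>1) + of_int b * h\<^sub>2"
    by (rule multiple[OF \<omega>\<^sub>2 period2]) (use z \<omega>\<^sub>1[of a] in auto)
  also have "f (z + of_int a * \<omega>\<^sub>1) = f z + of_int a * h\<^sub>1"
    by (rule multiple[OF \<omega>\<^sub>1 period1 z])
  finally show ?thesis by (simp add: add.assoc)
qed

lemma removable_lattice_singularities:
  assumes holo: "f holomorphic_on - \<Lambda>" and lim: "\<And>\<omega>. \<omega> \<in> \<Lambda> \<Longrightarrow> \<exists>l. f \<midarrow>\<omega>\<rightarrow> l"
  shows "remove_sings f holomorphic_on UNIV"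
    and "z \<notin> \<Lambda> \<Longrightarrow> remove_sings f z = f z"
proof -
  have analytic: "f analytic_on {z}" if "z \<notin> \<Lambda>" for z
    using holo open_Compl_lattice that by (auto simp: analytic_at)
  then show "remove_sings f z = f z" if "z \<notin> \<Lambda>" for z
    using that by simp
  have "remove_sings f analytic_on {z}" for z
  proof (cases "z \<in> \<Lambda>")
    case True
    have "eventually (\<lambda>w. f analytic_on {w}) (at z)"
      using eventually_not_in_lattice by eventually_elim (rule analytic)
    then have "isolated_singularity_at f z"
      by (simp add: isolated_singularity_at_altdef)
    with lim[OF True] show ?thesis
      by (auto intro: remove_sings_analytic_at)
  next
    case False
    then show ?thesis
      by (intro remove_sings_analytic_on analytic)
  qed
  then show "remove_sings f holomorphic_on UNIV"
    by (meson analytic_on_analytic_at analytic_imp_holomorphic)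
qed

lemma entire_elliptic_constant:
  assumes entire: "f holomorphic_on UNIV" and periodic: "\<And>z \<omega>. \<omega> \<in> \<Lambda> \<Longrightarrow> f (z + \<omega>) = f z"
  shows "f constant_on UNIV"
proof (rule Liouville_theorem[OF entire])
  let ?B = "cball 0 (norm \<omega>\<^sub>1 + norm \<omega>\<^sub>2)"
  have "range f \<subseteq> f ` ?B"
  proof clarify
    fix z
    obtain \<omega> where \<omega>: "\<omega> \<in> \<Lambda>" "norm (z - \<omega>) \<le> norm \<omega>\<^sub>1 + norm \<omega>\<^sub>2"
      using lattice_reduce .
    have "f z = f (z - \<omega>)" using periodic[OF \<omega>(1), of "z - \<omega>"] by simp
    then show "f z \<in> f ` ?B" using \<omega>(2) by auto
  qed
  moreover have "compact (f ` ?B)"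
    using entire by (intro compact_continuous_image)
      (auto intro: holomorphic_on_imp_continuous_on holomorphic_on_subset)
  ultimately show "bounded (range f)"
    by (meson bounded_subset compact_imp_bounded)
qed

lemma elliptic_constant:
  assumes holo: "f holomorphic_on - \<Lambda>"
    and period1: "\<And>z. z \<notin> \<Lambda> \<Longrightarrow> f (z + \<omega>\<^sub>1) = f z" and period2: "\<And>z. z \<notin> \<Lambda> \<Longrightarrow> f (z + \<omega>\<^sub>2) = f z"
    and lim: "f \<midarrow>0\<rightarrow> l" and z: "z \<notin> \<Lambda>"
  shows "f z = l"
proof -
  have periodic: "f (z + \<omega>) = f z" if "\<omega> \<in> \<Lambda>" "z \<notin> \<Lambda>" for \<omega> z
    using that additive_quasi_period_lattice[of f 0 0 z] period1 period2 by (auto simp: lattice_iff)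
  have lims: "f \<midarrow>\<omega>\<rightarrow> l" if "\<omega> \<in> \<Lambda>" for \<omega>
  proof -
    have "eventually (\<lambda>z. f z = f (z + \<omega>)) (at 0)"
      using eventually_not_in_lattice by eventually_elim (use periodic that in auto)
    with lim have "((\<lambda>z. f (z + \<omega>)) \<longlongrightarrow> l) (at 0)"
      by (rule Lim_transform_eventually)
    then show ?thesis using LIM_offset_zero_cancel[of f \<omega> l] by (simp add: add.commute)
  qed
  define g where "g = remove_sings f"
  have entire: "g holomorphic_on UNIV"
    unfolding g_def using removable_lattice_singularities(1)[OF holo] lims by blast
  have g_eq: "g z = f z" if "z \<notin> \<Lambda>" for z
    unfolding g_def using removable_lattice_singularities(2)[OF holo] lims that by blast
  have g_lattice: "g \<omega> = l" if "\<omega> \<in> \<Lambda>" for \<omega>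
    unfolding g_def by (rule remove_sings_eqI[OF lims[OF that]])
  have "g (z + \<omega>) = g z" if "\<omega> \<in> \<Lambda>" for z \<omega>
    using that by (cases "z \<in> \<Lambda>") (auto simp: g_eq g_lattice periodic)
  then have "g constant_on UNIV"
    by (intro entire_elliptic_constant entire)
  then have "g z = g 0"
    by (auto simp: constant_on_def)
  then show ?thesis
    using z by (simp add: g_eq g_lattice)
qed

lemma half_period_not_in_lattice: "\<omega>\<^sub>1 / 2 \<notin> \<Lambda>" "\<omega>\<^sub>2 / 2 \<notin> \<Lambda>"
proof -
  have not_int: "1 / 2 \<noteq> real_of_int n" for n
  proof
    assume "1 / 2 = real_of_int n"
    then have "real_of_int (2 * n) = 1" by simp
    then have "2 * n = 1" unfolding of_int_eq_1_iff .
    then show False by presburger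
  qed
  have coords: "coord1 \<omega> \<in> \<int>" "coord2 \<omega> \<in> \<int>" if "\<omega> \<in> \<Lambda>" for \<omega>
    using that by (auto simp: lattice_iff)
  have "coord1 (\<omega>\<^sub>1 / 2) = 1 / 2" "coord2 (\<omega>\<^sub>2 / 2) = 1 / 2"
    using coord1_combination[of "1 / 2" 0] coord2_combination[of 0 "1 / 2"] by simp_all
  then show "\<omega>\<^sub>1 / 2 \<notin> \<Lambda>" "\<omega>\<^sub>2 / 2 \<notin> \<Lambda>"
    using coords not_int by (metis Ints_cases)+
qed

end

section \<open>The Weierstrass zeta function and its quasi-periods\<close>

lemma summable_on_int_powr:
  assumes "p < - 1"
  shows "(\<lambda>n::int. (1 + \<bar>real_of_int n\<bar>) powr p) summable_on UNIV"
proof -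
  let ?f = "\<lambda>n::int. (1 + \<bar>real_of_int n\<bar>) powr p"
  have "summable (\<lambda>n. real (Suc n) powr p)"
    using assms by (subst summable_Suc_iff) (simp add: summable_real_powr_iff)
  then have nat: "(\<lambda>n. (1 + real n) powr p) summable_on UNIV"
    by (subst summable_on_UNIV_nonneg_real_iff) (auto simp: add.commute)
  have "?f summable_on range int"
    by (subst summable_on_reindex) (use nat in \<open>auto simp: o_def\<close>)
  moreover have "?f summable_on range (\<lambda>n. - int n)"
    by (subst summable_on_reindex) (use nat in \<open>auto simp: o_def inj_on_def\<close>)
  ultimately have "?f summable_on (range int \<union> range (\<lambda>n. - int n))"
    by (rule summable_on_union)
  also have "range int \<union> range (\<lambda>n. - int n) = UNIV"
    by (auto simp: image_iff) (metis int_cases2)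
  finally show ?thesis .
qed

lemma summable_on_int_pairs_powr:
  assumes "p < - 2"
  shows "(\<lambda>(a, b). (1 + \<bar>real_of_int a\<bar> + \<bar>real_of_int b\<bar>) powr p) summable_on UNIV"
proof -
  define f where "f = (\<lambda>n::int. (1 + \<bar>real_of_int n\<bar>) powr (p / 2))"
  have f: "f summable_on UNIV"
    unfolding f_def using assms by (intro summable_on_int_powr) simp
  have "(\<lambda>(a, b). f a * f b) summable_on (UNIV \<times> UNIV)"
  proof (rule summable_on_SigmaI)
    show "((\<lambda>b. case (a, b) of (a, b) \<Rightarrow> f a * f b) has_sum f a * infsum f UNIV) UNIV" for a
      using f by (auto intro: has_sum_cmult_right)
    show "(\<lambda>a. f a * infsum f UNIV) summable_on UNIV"
      using f by (rule summable_on_cmult_left)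
  qed (auto simp: f_def)
  then have "(\<lambda>(a, b). f a * f b) summable_on UNIV" by simp
  then show ?thesis
  proof (rule summable_on_comparison_test)
    fix ab :: "int \<times> int"
    obtain a b where ab: "ab = (a, b)" by (cases ab)
    define h where "h = 1 + \<bar>real_of_int a\<bar> + \<bar>real_of_int b\<bar>"
    have h: "1 + \<bar>real_of_int a\<bar> \<le> h" "1 + \<bar>real_of_int b\<bar> \<le> h"
      by (simp_all add: h_def)
    have "h powr p = h powr (p / 2) * h powr (p / 2)"
      by (simp add: powr_add[symmetric])
    also have "\<dots> \<le> f a * f b"
      unfolding f_def using h assms by (intro mult_mono powr_mono2') auto
    finally show "(case ab of (a, b) \<Rightarrow> (1 + \<bar>real_of_int a\<bar> + \<bar>real_of_int b\<bar>) powr p)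
        \<le> (case ab of (a, b) \<Rightarrow> f a * f b)"
      by (simp add: ab h_def)
  qed auto
qed

lemma eq_deriv_imp_diff_constant:
  fixes f g :: "complex \<Rightarrow> complex"
  assumes S: "open S" "connected S" and holo: "f holomorphic_on S" "g holomorphic_on S"
    and deriv: "\<And>z. z \<in> S \<Longrightarrow> deriv f z = deriv g z"
  obtains c where "\<And>z. z \<in> S \<Longrightarrow> f z = g z + c"
proof -
  have "((\<lambda>z. f z - g z) has_field_derivative 0) (at z)" if "z \<in> S" for z
    using DERIV_diff[OF holomorphic_derivI[OF holo(1) S(1) that] holomorphic_derivI[OF holo(2) S(1) that]]
      deriv[OF that] by simp
  then have "(\<lambda>z. f z - g z) constant_on S"
    using S by (intro has_field_derivative_0_imp_constant_on) auto
  then show ?thesis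
    using that by (auto simp: constant_on_def diff_eq_eq add.commute)
qed

lemma higher_deriv_sum:
  fixes f :: "'a \<Rightarrow> complex \<Rightarrow> complex"
  assumes "open A" "z \<in> A" and holo: "\<And>i. i \<in> X \<Longrightarrow> f i holomorphic_on A"
  shows "(deriv ^^ n) (\<lambda>x. \<Sum>i\<in>X. f i x) z = (\<Sum>i\<in>X. (deriv ^^ n) (f i) z)"
  using holo
proof (induction X rule: infinite_finite_induct)
  case (insert i X)
  then have "(deriv ^^ n) (\<lambda>x. f i x + (\<Sum>i\<in>X. f i x)) z =
      (deriv ^^ n) (f i) z + (deriv ^^ n) (\<lambda>x. \<Sum>i\<in>X. f i x) z"
    using assms(1,2) by (intro higher_deriv_add[of _ A]) (auto intro!: holomorphic_intros)
  with insert show ?case by simp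
qed auto

definition zeta_term :: "complex \<Rightarrow> complex \<Rightarrow> complex" where
  "zeta_term z \<omega> = 1 / (z - \<omega>) + 1 / \<omega> + z / \<omega>\<^sup>2"

lemma zeta_term_holomorphic: "\<omega> \<notin> A \<Longrightarrow> (\<lambda>z. zeta_term z \<omega>) holomorphic_on A"
  unfolding zeta_term_def by (auto intro!: holomorphic_intros)

lemma norm_zeta_term_le:
  assumes "\<omega> \<noteq> 0" and R: "norm z \<le> R" and r: "r > 0" "r \<le> norm (z - \<omega>)"
  shows "norm (zeta_term z \<omega>) \<le> R\<^sup>2 * (1 + R / r) / norm \<omega> ^ 3"
proof -
  have "z - \<omega> \<noteq> 0" using r by auto
  have "R \<ge> 0" using R norm_ge_zero order.trans by blast
  have "norm \<omega> \<le> norm (z - \<omega>) + R * 1"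
    using norm_triangle_ineq2[of \<omega> z] R by (simp add: norm_minus_commute)
  also have "\<dots> \<le> norm (z - \<omega>) + R * (norm (z - \<omega>) / r)"
    using r \<open>R \<ge> 0\<close> by (intro add_left_mono mult_left_mono) (auto simp: field_simps)
  finally have \<omega>_le: "norm \<omega> \<le> (1 + R / r) * norm (z - \<omega>)"
    by (simp add: algebra_simps)
  have "zeta_term z \<omega> = z\<^sup>2 / (\<omega>\<^sup>2 * (z - \<omega>))"
    using \<open>\<omega> \<noteq> 0\<close> \<open>z - \<omega> \<noteq> 0\<close> by (simp add: zeta_term_def field_simps power2_eq_square)
  then have "norm (zeta_term z \<omega>) = norm z ^ 2 * (1 / (norm \<omega> ^ 2 * norm (z - \<omega>)))"
    by (simp add: norm_divide norm_mult norm_power)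
  also have "\<dots> \<le> R\<^sup>2 * ((1 + R / r) / norm \<omega> ^ 3)"
  proof (intro mult_mono power_mono R)
    show "1 / (norm \<omega> ^ 2 * norm (z - \<omega>)) \<le> (1 + R / r) / norm \<omega> ^ 3"
      using \<omega>_le \<open>\<omega> \<noteq> 0\<close> \<open>z - \<omega> \<noteq> 0\<close> by (simp add: power3_eq_cube power2_eq_square field_simps)
  qed auto
  finally show ?thesis by simp
qed

lemma second_deriv_zeta_term:
  assumes "z \<noteq> \<omega>"
  shows "(deriv ^^ 2) (\<lambda>z. zeta_term z \<omega>) z = 2 / (z - \<omega>) ^ 3"
proof -
  have first: "deriv (\<lambda>z. zeta_term z \<omega>) z = 1 / \<omega>\<^sup>2 - inverse (z - \<omega>) ^ 2" if "z \<noteq> \<omega>" for z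
  proof (rule DERIV_imp_deriv)
    have "((\<lambda>z. inverse (z - \<omega>) + a + z * b) has_field_derivative b - inverse (z - \<omega>) ^ 2) (at z)" for a b
      using that by (auto intro!: derivative_eq_intros simp: power2_eq_square)
    from this[of "1 / \<omega>" "1 / \<omega>\<^sup>2"]
    show "((\<lambda>z. zeta_term z \<omega>) has_field_derivative 1 / \<omega>\<^sup>2 - inverse (z - \<omega>) ^ 2) (at z)"
      by (simp add: zeta_term_def divide_inverse)
  qed
  have second: "((\<lambda>z. a - inverse (z - \<omega>) ^ 2) has_field_derivative 2 * inverse (z - \<omega>) ^ 3) (at z)" for a
    using assms by (auto intro!: derivative_eq_intros simp: power3_eq_cube)
  have "eventually (\<lambda>z. z \<noteq> \<omega>) (nhds z)"
    using assms by (rule t1_space_nhds)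
  then have "eventually (\<lambda>z. deriv (\<lambda>z. zeta_term z \<omega>) z = 1 / \<omega>\<^sup>2 - inverse (z - \<omega>) ^ 2) (nhds z)"
    by eventually_elim (rule first)
  then have "(deriv ^^ 2) (\<lambda>z. zeta_term z \<omega>) z = deriv (\<lambda>z. 1 / \<omega>\<^sup>2 - inverse (z - \<omega>) ^ 2) z"
    by (simp add: eval_nat_numeral deriv_cong_ev)
  also have "\<dots> = 2 * inverse (z - \<omega>) ^ 3"
    using second by (rule DERIV_imp_deriv)
  finally show ?thesis
    by (simp only: divide_inverse power_inverse)
qed

context complex_lattice
begin

abbreviation zeta :: "complex \<Rightarrow> complex" ("\<zeta>") where
  "\<zeta> z \<equiv> weierstrass_zeta z \<Lambda>"

lemma inj_int_combination: "inj (\<lambda>(a, b). of_int a * \<omega>\<^sub>1 + of_int b * \<omega>\<^sub>2)"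
proof (rule injI, clarify)
  fix a b c d assume "of_int a * \<omega>\<^sub>1 + of_int b * \<omega>\<^sub>2 = of_int c * \<omega>\<^sub>1 + of_int d * \<omega>\<^sub>2"
  from arg_cong[OF this, of coord1] arg_cong[OF this, of coord2] show "a = c \<and> b = d"
    by simp
qed

lemma lattice_inverse_cube_le:
  obtains C where "\<And>a b::int. 1 / norm (of_int a * \<omega>\<^sub>1 + of_int b * \<omega>\<^sub>2) ^ 3 \<le>
    C * (1 + \<bar>real_of_int a\<bar> + \<bar>real_of_int b\<bar>) powr (- 3)"
proof -
  obtain d where d: "d > 0"
    "\<And>a b::int. norm (of_int a * \<omega>\<^sub>1 + of_int b * \<omega>\<^sub>2) \<ge> d * (\<bar>real_of_int a\<bar> + \<bar>real_of_int b\<bar>)"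
    using lattice_norm_ge by blast
  have "1 / norm (of_int a * \<omega>\<^sub>1 + of_int b * \<omega>\<^sub>2) ^ 3 \<le>
      (2 / d) ^ 3 * (1 + \<bar>real_of_int a\<bar> + \<bar>real_of_int b\<bar>) powr (- 3)" for a b :: int
  proof (cases "a = 0 \<and> b = 0")
    case False
    define h where "h = 1 + \<bar>real_of_int a\<bar> + \<bar>real_of_int b\<bar>"
    from False have "\<bar>a\<bar> + \<bar>b\<bar> \<ge> 1" by auto
    then have "1 \<le> \<bar>real_of_int a\<bar> + \<bar>real_of_int b\<bar>"
      by linarith
    then have "h \<le> 2 * (\<bar>real_of_int a\<bar> + \<bar>real_of_int b\<bar>)"
      by (simp add: h_def)
    then have "d * h \<le> d * (2 * (\<bar>real_of_int a\<bar> + \<bar>real_of_int b\<bar>))"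
      using d(1) by (intro mult_left_mono) auto
    also have "\<dots> \<le> 2 * norm (of_int a * \<omega>\<^sub>1 + of_int b * \<omega>\<^sub>2)"
      using d(2)[of a b] by (simp add: algebra_simps)
    finally have "d / 2 * h \<le> norm (of_int a * \<omega>\<^sub>1 + of_int b * \<omega>\<^sub>2)"
      by simp
    moreover have "d / 2 * h > 0"
      using d(1) by (simp add: h_def)
    ultimately have "1 / norm (of_int a * \<omega>\<^sub>1 + of_int b * \<omega>\<^sub>2) ^ 3 \<le> 1 / (d / 2 * h) ^ 3"
      by (intro frac_le power_mono) auto
    also have "1 / (d / 2 * h) ^ 3 = (2 / d) ^ 3 * h powr (- 3)"
      by (simp add: h_def powr_minus inverse_eq_divide power_mult_distrib power_divide)
    finally show ?thesis
      by (simp add: h_def)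
  qed (use d(1) in simp)
  then show ?thesis by (rule that)
qed

lemma summable_on_lattice_inverse_cube: "(\<lambda>\<omega>. 1 / norm \<omega> ^ 3) summable_on \<Lambda>"
proof -
  let ?p = "\<lambda>(a, b). of_int a * \<omega>\<^sub>1 + of_int b * \<omega>\<^sub>2"
  obtain C where C: "\<And>a b::int. 1 / norm (of_int a * \<omega>\<^sub>1 + of_int b * \<omega>\<^sub>2) ^ 3 \<le>
      C * (1 + \<bar>real_of_int a\<bar> + \<bar>real_of_int b\<bar>) powr (- 3)"
    using lattice_inverse_cube_le by blast
  have "(\<lambda>p. 1 / norm (?p p) ^ 3) summable_on UNIV"
    by (rule summable_on_comparison_test
        [OF summable_on_cmult_right[OF summable_on_int_pairs_powr[of "- 3"], of C]]) (use C in auto)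
  then have "(\<lambda>\<omega>. 1 / norm \<omega> ^ 3) summable_on range ?p"
    using inj_int_combination by (subst summable_on_reindex) (auto simp: o_def)
  moreover have "range ?p = \<Lambda>"
    by (auto simp: lattice_def)
  ultimately show ?thesis by simp
qed

lemma zeta_term_summable_majorant:
  assumes "s > 0"
  obtains M where "M summable_on \<Lambda>"
    "\<And>\<omega> z. norm z \<le> R \<Longrightarrow> s \<le> norm (z - \<omega>) \<Longrightarrow> norm (zeta_term z \<omega>) \<le> M \<omega>"
proof
  let ?M = "\<lambda>\<omega>::complex. if \<omega> = 0 then 1 / s else R\<^sup>2 * (1 + R / s) * (1 / norm \<omega> ^ 3)"
  have "?M summable_on \<Lambda> - {0}"
    by (rule summable_on_cong[THEN iffD1, rotated, OF summable_on_cmult_right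
          [OF summable_on_subset[OF summable_on_lattice_inverse_cube]]]) auto
  then show "?M summable_on \<Lambda>"
    using summable_on_insert_iff[of ?M 0 "\<Lambda> - {0}"] by (simp add: insert_absorb)
  show "norm (zeta_term z \<omega>) \<le> ?M \<omega>" if z: "norm z \<le> R" "s \<le> norm (z - \<omega>)" for \<omega> z
  proof (cases "\<omega> = 0")
    case True
    then have "norm (zeta_term z \<omega>) = 1 / norm z" by (simp add: zeta_term_def norm_divide)
    also have "\<dots> \<le> 1 / s"
      using z assms True by (intro divide_left_mono mult_pos_pos) auto
    finally show ?thesis using True by simp
  next
    case False
    then show ?thesis
      using norm_zeta_term_le[OF False z(1) assms z(2)] by simp
  qed
qed

text \<open>Since \<open>1 / 0 = 0\<close>, the summand for \<open>\<omega> = 0\<close> is \<open>1 / z\<close>, so that \<open>zeta_sum \<Lambda>\<close> is \<open>\<zeta>\<close> itself.\<close>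

definition zeta_sum :: "complex set \<Rightarrow> complex \<Rightarrow> complex" where
  "zeta_sum S z = (\<Sum>\<^sub>\<infinity>\<omega>\<in>S. zeta_term z \<omega>)"

lemma zeta_sum_uniform_limit:
  assumes S: "S \<subseteq> \<Lambda>" and z: "z \<notin> S"
  obtains s where "s > 0" "cball z s \<inter> S = {}"
    "uniform_limit (cball z s) (\<lambda>X x. \<Sum>\<omega>\<in>X. zeta_term x \<omega>) (zeta_sum S) (finite_subsets_at_top S)"
proof -
  obtain r where r: "r > 0" "ball z r \<subseteq> - S"
    using z openE[OF open_Compl_lattice_subset[OF S], of z] by auto
  define s where "s = r / 2"
  have s: "s > 0" using r by (simp add: s_def)
  have dist: "s \<le> norm (x - \<omega>)" if "x \<in> cball z s" "\<omega> \<in> S" for x \<omega>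
  proof -
    have "r \<le> dist z \<omega>" using r(2) that(2) by force
    then show ?thesis
      using that(1) dist_triangle[of z \<omega> x] by (simp add: s_def dist_norm)
  qed
  have R: "norm x \<le> norm z + s" if "x \<in> cball z s" for x
    using that norm_triangle_ineq2[of x z] by (simp add: dist_norm norm_minus_commute)
  obtain M where M: "M summable_on \<Lambda>"
    "\<And>\<omega> x. norm x \<le> norm z + s \<Longrightarrow> s \<le> norm (x - \<omega>) \<Longrightarrow> norm (zeta_term x \<omega>) \<le> M \<omega>"
    using zeta_term_summable_majorant[OF s] by blast
  have "uniform_limit (cball z s) (\<lambda>X x. \<Sum>\<omega>\<in>X. zeta_term x \<omega>) (zeta_sum S) (finite_subsets_at_top S)"
    unfolding zeta_sum_def[abs_def]
    by (rule Weierstrass_m_test_general[OF _ summable_on_subset[OF M(1) S]]) (intro M(2) R dist)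
  moreover have "cball z s \<inter> S = {}"
    using dist s by fastforce
  ultimately show ?thesis using that s by blast
qed

lemma zeta_sum_has_sum:
  assumes "S \<subseteq> \<Lambda>" "z \<notin> S"
  shows "(zeta_term z has_sum zeta_sum S z) S"
proof -
  obtain s where "s > 0"
    "uniform_limit (cball z s) (\<lambda>X x. \<Sum>\<omega>\<in>X. zeta_term x \<omega>) (zeta_sum S) (finite_subsets_at_top S)"
    using zeta_sum_uniform_limit[OF assms] by metis
  then show ?thesis
    unfolding has_sum_def using tendsto_uniform_limitI[where x = z] by force
qed

lemma zeta_partial_sums_holomorphic:
  "eventually (\<lambda>X. (\<lambda>x. \<Sum>\<omega>\<in>X. zeta_term x \<omega>) holomorphic_on - S) (finite_subsets_at_top S)"
  by (rule eventually_finite_subsets_at_top_weakI) (auto intro!: holomorphic_on_sum zeta_term_holomorphic)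

lemma zeta_sum_holomorphic:
  assumes S: "S \<subseteq> \<Lambda>"
  shows "zeta_sum S holomorphic_on - S"
proof -
  have "zeta_sum S analytic_on {z}" if z: "z \<notin> S" for z
  proof -
    obtain s where s: "s > 0" "cball z s \<inter> S = {}" and
      limit: "uniform_limit (cball z s) (\<lambda>X x. \<Sum>\<omega>\<in>X. zeta_term x \<omega>) (zeta_sum S) (finite_subsets_at_top S)"
      using zeta_sum_uniform_limit[OF S z] by metis
    have "eventually (\<lambda>X. continuous_on (cball z s) (\<lambda>x. \<Sum>\<omega>\<in>X. zeta_term x \<omega>) \<and>
        (\<lambda>x. \<Sum>\<omega>\<in>X. zeta_term x \<omega>) holomorphic_on ball z s) (finite_subsets_at_top S)"
      using zeta_partial_sums_holomorphic
    proof eventually_elim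
      case (elim X)
      then have "(\<lambda>x. \<Sum>\<omega>\<in>X. zeta_term x \<omega>) holomorphic_on cball z s"
        by (rule holomorphic_on_subset) (use s in auto)
      then show ?case
        by (auto intro: holomorphic_on_imp_continuous_on holomorphic_on_subset[OF _ ball_subset_cball])
    qed
    from holomorphic_uniform_limit[OF this limit] have "zeta_sum S holomorphic_on ball z s" by auto
    then show ?thesis using s(1) by (auto simp: analytic_at intro: exI[of _ "ball z s"])
  qed
  then show ?thesis
    by (metis ComplD analytic_imp_holomorphic analytic_on_analytic_at)
qed

lemma zeta_sum_second_deriv:
  assumes S: "S \<subseteq> \<Lambda>" and z: "z \<notin> S"
  shows "((\<lambda>\<omega>. 2 / (z - \<omega>) ^ 3) has_sum (deriv ^^ 2) (zeta_sum S) z) S"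
proof -
  obtain s where s: "s > 0" "cball z s \<inter> S = {}" and
    limit: "uniform_limit (cball z s) (\<lambda>X x. \<Sum>\<omega>\<in>X. zeta_term x \<omega>) (zeta_sum S) (finite_subsets_at_top S)"
    using zeta_sum_uniform_limit[OF S z] by metis
  have "((\<lambda>X. (deriv ^^ 2) (\<lambda>x. \<Sum>\<omega>\<in>X. zeta_term x \<omega>) z) \<longlongrightarrow> (deriv ^^ 2) (zeta_sum S) z)
      (finite_subsets_at_top S)"
  proof (rule higher_deriv_complex_uniform_limit)
    show "uniform_limit (ball z s) (\<lambda>X x. \<Sum>\<omega>\<in>X. zeta_term x \<omega>) (zeta_sum S) (finite_subsets_at_top S)"
      using limit by (rule uniform_limit_on_subset) auto
    show "eventually (\<lambda>X. (\<lambda>x. \<Sum>\<omega>\<in>X. zeta_term x \<omega>) holomorphic_on ball z s) (finite_subsets_at_top S)"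
      using zeta_partial_sums_holomorphic
      by eventually_elim (use s ball_subset_cball[of z s] in \<open>blast intro: holomorphic_on_subset\<close>)
  qed (use s in auto)
  moreover have "eventually (\<lambda>X. (deriv ^^ 2) (\<lambda>x. \<Sum>\<omega>\<in>X. zeta_term x \<omega>) z = (\<Sum>\<omega>\<in>X. 2 / (z - \<omega>) ^ 3))
      (finite_subsets_at_top S)"
  proof (rule eventually_finite_subsets_at_top_weakI)
    fix X assume "finite X" "X \<subseteq> S"
    then have "(deriv ^^ 2) (\<lambda>x. \<Sum>\<omega>\<in>X. zeta_term x \<omega>) z = (\<Sum>\<omega>\<in>X. (deriv ^^ 2) (\<lambda>x. zeta_term x \<omega>) z)"
      using s ball_subset_cball[of z s]
      by (intro higher_deriv_sum[of "ball z s"] zeta_term_holomorphic; force)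
    also have "\<dots> = (\<Sum>\<omega>\<in>X. 2 / (z - \<omega>) ^ 3)"
      using z \<open>X \<subseteq> S\<close> by (intro sum.cong second_deriv_zeta_term) auto
    finally show "(deriv ^^ 2) (\<lambda>x. \<Sum>\<omega>\<in>X. zeta_term x \<omega>) z = (\<Sum>\<omega>\<in>X. 2 / (z - \<omega>) ^ 3)" .
  qed
  ultimately show ?thesis
    unfolding has_sum_def by (rule Lim_transform_eventually)
qed

lemma zeta_sum_split:
  assumes "\<omega> \<in> \<Lambda>" "z \<notin> \<Lambda> - {\<omega>}"
  shows "zeta_sum \<Lambda> z = zeta_term z \<omega> + zeta_sum (\<Lambda> - {\<omega>}) z"
proof -
  have "(zeta_term z has_sum (zeta_term z \<omega> + zeta_sum (\<Lambda> - {\<omega>}) z)) (insert \<omega> (\<Lambda> - {\<omega>}))"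
    by (rule has_sum_insert[OF _ zeta_sum_has_sum]) (use assms in auto)
  then show ?thesis
    using assms(1) by (simp add: zeta_sum_def insert_absorb infsumI)
qed

lemma zeta_eq_zeta_sum: "z \<notin> \<Lambda> \<Longrightarrow> \<zeta> z = zeta_sum \<Lambda> z"
  using zeta_sum_split[of 0 z]
  by (simp add: weierstrass_zeta_def zeta_sum_def zeta_term_def)

lemma zeta_holomorphic: "\<zeta> holomorphic_on - \<Lambda>"
  using zeta_sum_holomorphic[OF order.refl] by (rule holomorphic_transform) (simp add: zeta_eq_zeta_sum)

lemma zeta_simple_pole:
  assumes "\<omega> \<in> \<Lambda>"
  obtains g where "g holomorphic_on - (\<Lambda> - {\<omega>})" "\<And>z. z \<notin> \<Lambda> \<Longrightarrow> \<zeta> z = 1 / (z - \<omega>) + g z"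
proof
  let ?g = "\<lambda>z. 1 / \<omega> + z / \<omega>\<^sup>2 + zeta_sum (\<Lambda> - {\<omega>}) z"
  have "zeta_sum (\<Lambda> - {\<omega>}) holomorphic_on - (\<Lambda> - {\<omega>})"
    by (rule zeta_sum_holomorphic) auto
  then show "?g holomorphic_on - (\<Lambda> - {\<omega>})"
    unfolding divide_inverse by (intro holomorphic_intros)
  show "\<zeta> z = 1 / (z - \<omega>) + ?g z" if "z \<notin> \<Lambda>" for z
    using zeta_eq_zeta_sum[OF that] zeta_sum_split[OF assms, of z] that by (simp add: zeta_term_def)
qed

lemma zeta_second_deriv:
  assumes "z \<notin> \<Lambda>"
  shows "((\<lambda>\<omega>. 2 / (z - \<omega>) ^ 3) has_sum (deriv ^^ 2) \<zeta> z) \<Lambda>"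
proof -
  have "eventually (\<lambda>x. \<zeta> x = zeta_sum \<Lambda> x) (nhds z)"
    using eventually_nhds_in_open[OF open_Compl_lattice, of z] assms
    by (force elim: eventually_mono simp: zeta_eq_zeta_sum)
  then have "(deriv ^^ 2) \<zeta> z = (deriv ^^ 2) (zeta_sum \<Lambda>) z"
    by (rule higher_deriv_cong_ev) simp
  then show ?thesis
    using zeta_sum_second_deriv[OF order.refl assms] by simp
qed

lemma zeta_minus: "\<zeta> (- z) = - \<zeta> z"
proof -
  have "bij_betw uminus (\<Lambda> - {0}) (\<Lambda> - {0})"
    by (rule bij_betwI[of _ _ _ uminus]) auto
  then have "zeta_sum (\<Lambda> - {0}) (- z) = (\<Sum>\<^sub>\<infinity>\<omega>\<in>\<Lambda> - {0}. zeta_term (- z) (- \<omega>))"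
    unfolding zeta_sum_def by (rule infsum_reindex_bij_betw[symmetric])
  also have "\<dots> = (\<Sum>\<^sub>\<infinity>\<omega>\<in>\<Lambda> - {0}. - zeta_term z \<omega>)"
  proof (rule infsum_cong)
    fix \<omega>
    have "1 / (- z - - \<omega>) = - (1 / (z - \<omega>))"
      by (metis minus_diff_eq minus_diff_minus minus_divide_right)
    then show "zeta_term (- z) (- \<omega>) = - zeta_term z \<omega>" by (simp add: zeta_term_def)
  qed
  finally have "zeta_sum (\<Lambda> - {0}) (- z) = - zeta_sum (\<Lambda> - {0}) z"
    by (simp add: zeta_sum_def infsum_uminus)
  then show ?thesis
    by (simp add: weierstrass_zeta_def zeta_sum_def zeta_term_def)
qed

lemma translation_difference_constant:
  assumes f: "f holomorphic_on - \<Lambda>" and \<omega>: "\<omega> \<in> \<Lambda>"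
    and deriv: "\<And>z. z \<notin> \<Lambda> \<Longrightarrow> deriv f (z + \<omega>) = deriv f z"
  obtains c where "\<And>z. z \<notin> \<Lambda> \<Longrightarrow> f (z + \<omega>) = f z + c"
proof -
  have shift: "((\<lambda>z. f (z + \<omega>)) has_field_derivative deriv f z) (at z)" if "z \<in> - \<Lambda>" for z
    using holomorphic_derivI[OF f open_Compl_lattice, of "z + \<omega>" UNIV] deriv[of z] that \<omega>
    by (simp add: DERIV_shift[symmetric])
  show ?thesis
  proof (rule eq_deriv_imp_diff_constant[OF open_Compl_lattice connected_Compl_lattice _ f])
    show "(\<lambda>z. f (z + \<omega>)) holomorphic_on - \<Lambda>"
      unfolding holomorphic_on_open[OF open_Compl_lattice] using shift by blast
    show "deriv (\<lambda>z. f (z + \<omega>)) z = deriv f z" if "z \<in> - \<Lambda>" for z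
      using DERIV_imp_deriv[OF shift[OF that]] .
  qed (use that in auto)
qed

lemma deriv_zeta_minus:
  assumes "z \<notin> \<Lambda>"
  shows "deriv \<zeta> (- z) = deriv \<zeta> z"
proof -
  have "((\<lambda>z. \<zeta> (- z)) has_field_derivative deriv \<zeta> (- z) * (- 1)) (at z)"
    by (rule DERIV_chain2[OF holomorphic_derivI[OF zeta_holomorphic open_Compl_lattice]])
       (use assms in \<open>auto intro!: derivative_eq_intros\<close>)
  then have "((\<lambda>z. - \<zeta> z) has_field_derivative - deriv \<zeta> (- z)) (at z)"
    by (simp add: zeta_minus)
  moreover have "((\<lambda>z. - \<zeta> z) has_field_derivative - deriv \<zeta> z) (at z)"
    by (rule DERIV_minus[OF holomorphic_derivI[OF zeta_holomorphic open_Compl_lattice]])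
       (use assms in auto)
  ultimately show ?thesis
    using DERIV_unique by fastforce
qed

text \<open>The constant by which \<open>\<zeta>'\<close> changes is found to be \<open>0\<close> at \<open>- \<omega> / 2\<close>, because \<open>\<zeta>'\<close> is even.\<close>

lemma zeta_quasi_period_exists:
  assumes \<omega>: "\<omega> \<in> \<Lambda>" and half: "\<omega> / 2 \<notin> \<Lambda>"
  obtains h where "\<And>z. z \<notin> \<Lambda> \<Longrightarrow> \<zeta> (z + \<omega>) = \<zeta> z + h"
proof -
  have bij: "bij_betw (\<lambda>x. x + \<omega>) \<Lambda> \<Lambda>"
    by (rule bij_betwI[of _ _ _ "\<lambda>x. x - \<omega>"]) (use \<omega> in auto)
  have second: "(deriv ^^ 2) \<zeta> (z + \<omega>) = (deriv ^^ 2) \<zeta> z" if z: "z \<notin> \<Lambda>" for z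
  proof -
    have "((\<lambda>x. 2 / (z + \<omega> - (x + \<omega>)) ^ 3) has_sum (deriv ^^ 2) \<zeta> (z + \<omega>)) \<Lambda>"
      using zeta_second_deriv[of "z + \<omega>"] z \<omega>
      by (subst has_sum_reindex_bij_betw[OF bij, of "\<lambda>x. 2 / (z + \<omega> - x) ^ 3"]) auto
    then show ?thesis
      using zeta_second_deriv[OF z] by (simp add: has_sum_unique)
  qed
  have "deriv \<zeta> holomorphic_on - \<Lambda>"
    by (rule holomorphic_deriv[OF zeta_holomorphic open_Compl_lattice])
  from translation_difference_constant[OF this \<omega>]
  obtain c where c: "\<And>z. z \<notin> \<Lambda> \<Longrightarrow> deriv \<zeta> (z + \<omega>) = deriv \<zeta> z + c"
    using second by (auto simp: eval_nat_numeral)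
  have "deriv \<zeta> (\<omega> / 2) = deriv \<zeta> (- (\<omega> / 2)) + c"
    using c[of "- (\<omega> / 2)"] half by simp
  then have "c = 0"
    using deriv_zeta_minus[OF half] by simp
  with translation_difference_constant[OF zeta_holomorphic \<omega>] c that show ?thesis
    by auto
qed

lemma linear_quasi_period_map_unique:
  assumes f: "linear f" "\<And>\<omega> z. \<omega> \<in> \<Lambda> \<Longrightarrow> z \<notin> \<Lambda> \<Longrightarrow> \<zeta> (z + \<omega>) = \<zeta> z + f \<omega>"
    and g: "linear g" "\<And>\<omega> z. \<omega> \<in> \<Lambda> \<Longrightarrow> z \<notin> \<Lambda> \<Longrightarrow> \<zeta> (z + \<omega>) = \<zeta> z + g \<omega>"
  shows "f = g"
proof
  fix z
  have periods: "f \<omega> = g \<omega>" if "\<omega> \<in> \<Lambda>" for \<omega>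
    using f(2)[OF that half_period_not_in_lattice(1)] g(2)[OF that half_period_not_in_lattice(1)] by simp
  have "f (coord1 z *\<^sub>R \<omega>\<^sub>1 + coord2 z *\<^sub>R \<omega>\<^sub>2) = g (coord1 z *\<^sub>R \<omega>\<^sub>1 + coord2 z *\<^sub>R \<omega>\<^sub>2)"
    using f(1) g(1) by (simp add: linear_add linear_scale periods)
  moreover have "coord1 z *\<^sub>R \<omega>\<^sub>1 + coord2 z *\<^sub>R \<omega>\<^sub>2 = z"
    using coords_eq[of z, symmetric] by (simp only: scaleR_conv_of_real)
  ultimately show "f z = g z"
    by simp
qed

lemma linear_quasi_period_map_exists:
  obtains f where "linear f" "\<And>\<omega> z. \<omega> \<in> \<Lambda> \<Longrightarrow> z \<notin> \<Lambda> \<Longrightarrow> \<zeta> (z + \<omega>) = \<zeta> z + f \<omega>"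
proof -
  obtain h\<^sub>1 where h\<^sub>1: "\<And>z. z \<notin> \<Lambda> \<Longrightarrow> \<zeta> (z + \<omega>\<^sub>1) = \<zeta> z + h\<^sub>1"
    using zeta_quasi_period_exists[OF period1_in_lattice half_period_not_in_lattice(1)] by blast
  obtain h\<^sub>2 where h\<^sub>2: "\<And>z. z \<notin> \<Lambda> \<Longrightarrow> \<zeta> (z + \<omega>\<^sub>2) = \<zeta> z + h\<^sub>2"
    using zeta_quasi_period_exists[OF period2_in_lattice half_period_not_in_lattice(2)] by blast
  define f where "f = (\<lambda>z. coord1 z *\<^sub>R h\<^sub>1 + coord2 z *\<^sub>R h\<^sub>2)"
  have "linear f"
    unfolding f_def
    by (intro linear_compose_add linear_compose[OF linear_coord1, unfolded o_def]
        linear_compose[OF linear_coord2, unfolded o_def] linear_scaleR_left)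
  moreover have "\<zeta> (z + \<omega>) = \<zeta> z + f \<omega>" if \<omega>: "\<omega> \<in> \<Lambda>" and z: "z \<notin> \<Lambda>" for \<omega> z
  proof -
    obtain a b :: int where ab: "\<omega> = of_int a * \<omega>\<^sub>1 + of_int b * \<omega>\<^sub>2"
      using \<omega> unfolding lattice_iff by blast
    show ?thesis
      using additive_quasi_period_lattice[of \<zeta>, OF h\<^sub>1 h\<^sub>2 z, of a b]
      by (simp add: ab f_def scaleR_conv_of_real)
  qed
  ultimately show ?thesis using that by blast
qed

theorem zeta_add_lattice:
  assumes "\<omega> \<in> \<Lambda>" "z \<notin> \<Lambda>"
  shows "\<zeta> (z + \<omega>) = \<zeta> z + eta \<omega> \<Lambda>"
proof -
  let ?P = "\<lambda>f. linear f \<and> (\<forall>\<omega>\<in>\<Lambda>. \<forall>z. z \<notin> \<Lambda> \<longrightarrow> \<zeta> (z + \<omega>) = \<zeta> z + f \<omega>)"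
  obtain f where f: "linear f" "\<And>\<omega> z. \<omega> \<in> \<Lambda> \<Longrightarrow> z \<notin> \<Lambda> \<Longrightarrow> \<zeta> (z + \<omega>) = \<zeta> z + f \<omega>"
    using linear_quasi_period_map_exists by blast
  have "\<exists>!f. ?P f"
  proof (rule ex1I[of _ f])
    show "?P f" using f by blast
    show "g = f" if "?P g" for g
      by (rule linear_quasi_period_map_unique) (use f that in blast)+
  qed
  from theI'[OF this] show ?thesis
    using assms by (simp add: eta_def)
qed

end

section \<open>The Weierstrass sigma function\<close>

lemma entire_tendsto: "f holomorphic_on UNIV \<Longrightarrow> f \<midarrow>z\<rightarrow> f z"
  using holomorphic_on_imp_continuous_on[of f UNIV] by (simp add: continuous_on_eq_continuous_at isCont_def)

lemma higher_deriv_power_mult: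
  assumes "g holomorphic_on UNIV"
  shows "(deriv ^^ n) (\<lambda>z. (z - w) ^ n * g z) w = fact n * g w"
proof -
  let ?summand = "\<lambda>i. of_nat (n choose i) * (deriv ^^ i) (\<lambda>z. (z - w) ^ n) w * (deriv ^^ (n - i)) g w"
  have "(deriv ^^ n) (\<lambda>z. (z - w) ^ n * g z) w = (\<Sum>i = 0..n. ?summand i)"
    by (rule higher_deriv_mult[of _ UNIV]) (use assms in \<open>auto intro!: holomorphic_intros\<close>)
  also have "\<dots> = (\<Sum>i\<in>{n}. ?summand i)"
    by (rule sum.mono_neutral_right) (auto simp: higher_deriv_power)
  also have "\<dots> = fact n * g w"
    by (simp add: higher_deriv_power pochhammer_fact)
  finally show ?thesis .
qed

lemma entire_divide_linear:
  assumes "f holomorphic_on UNIV" "f w = 0"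
  obtains g where "g holomorphic_on UNIV" "\<And>z. f z = (z - w) * g z" "g w = deriv f w"
proof
  let ?g = "\<lambda>z. if z = w then deriv f w else (f z - f w) / (z - w)"
  show "?g holomorphic_on UNIV"
    using assms(1) by (rule pole_lemma) simp
  show "f z = (z - w) * ?g z" for z
    using assms(2) by simp
qed simp

lemma entire_divide_power:
  assumes "f holomorphic_on UNIV" "\<And>i. i < n \<Longrightarrow> (deriv ^^ i) f w = 0"
  obtains g where "g holomorphic_on UNIV" "\<And>z. f z = (z - w) ^ n * g z"
proof -
  have "\<exists>g. g holomorphic_on UNIV \<and> f = (\<lambda>z. (z - w) ^ n * g z)"
    using assms(2)
  proof (induction n)
    case 0
    then show ?case using assms(1) by (intro exI[of _ f]) simp
  next
    case (Suc n)
    then obtain g where g: "g holomorphic_on UNIV" "f = (\<lambda>z. (z - w) ^ n * g z)"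
      by auto
    then have "g w = 0"
      using Suc.prems[of n] higher_deriv_power_mult[OF g(1), of n w] by simp
    then obtain h where "h holomorphic_on UNIV" "\<And>z. g z = (z - w) * h z"
      using entire_divide_linear[OF g(1)] by blast
    then show ?case
      using g(2) by (intro exI[of _ h]) (auto simp: mult_ac)
  qed
  then show ?thesis using that by auto
qed

lemma deriv_nonzero_at_simple_zero:
  assumes f: "f holomorphic_on UNIV" and nonzero: "f u \<noteq> 0" and zero: "zorder f w = 1"
  shows "deriv f w \<noteq> 0"
proof -
  let ?g = "zor_poly f w"
  have "\<exists>z\<in>UNIV. f z \<noteq> 0" using nonzero by blast
  from zorder_exist_zero[OF f open_UNIV connected_UNIV UNIV_I this, of w]
  obtain r where r: "r > 0" and g: "?g holomorphic_on cball w r"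
    and factor: "\<And>z. z \<in> cball w r \<Longrightarrow> f z = ?g z * (z - w) \<and> ?g z \<noteq> 0"
    by (auto simp: zero)
  have "(?g has_field_derivative deriv ?g w) (at w)"
    using g r by (intro holomorphic_derivI[of _ "ball w r"]) (auto intro: holomorphic_on_subset)
  then have "((\<lambda>z. ?g z * (z - w)) has_field_derivative ?g w) (at w)"
    by (auto intro!: derivative_eq_intros)
  moreover have "eventually (\<lambda>z. ?g z * (z - w) = f z) (nhds w)"
    using eventually_nhds_in_open[of "ball w r" w] r factor by (auto elim!: eventually_mono)
  ultimately have "deriv f w = ?g w"
    by (metis DERIV_imp_deriv deriv_cong_ev)
  then show ?thesis
    using factor r by simp
qed

lemma logderiv_limit_at_simple_zero:
  assumes f: "f holomorphic_on UNIV" and zero: "f w = 0" "deriv f w \<noteq> 0"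
  obtains l where "(\<lambda>z. deriv f z / f z - 1 / (z - w)) \<midarrow>w\<rightarrow> l"
proof -
  obtain g where g: "g holomorphic_on UNIV" "\<And>z. f z = (z - w) * g z" "g w = deriv f w"
    using entire_divide_linear[OF f zero(1)] by blast
  have "((\<lambda>z. deriv g z / g z) \<longlongrightarrow> deriv g w / g w) (at w)"
    using holomorphic_deriv[OF g(1) open_UNIV] g(1,3) zero(2) by (intro tendsto_divide entire_tendsto) auto
  moreover have "eventually (\<lambda>z. deriv g z / g z = deriv f z / f z - 1 / (z - w)) (at w)"
  proof -
    have "eventually (\<lambda>z. z \<noteq> w \<and> g z \<noteq> 0) (at w)"
      using entire_tendsto[OF g(1), of w] g(3) zero(2)
      by (intro eventually_conj tendsto_imp_eventually_ne[of g "g w"]) (auto simp: eventually_at_filter)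
    then show ?thesis
    proof eventually_elim
      case (elim z)
      have "((\<lambda>z. (z - w) * g z) has_field_derivative g z + (z - w) * deriv g z) (at z)"
        using holomorphic_derivI[OF g(1) open_UNIV, of z] by (auto intro!: derivative_eq_intros)
      then have "deriv f z = g z + (z - w) * deriv g z"
        using g(2) by (metis (no_types, lifting) DERIV_imp_deriv ext)
      then show ?case
        using elim g(2)[of z] by (simp add: add_divide_distrib)
    qed
  qed
  ultimately have "(\<lambda>z. deriv f z / f z - 1 / (z - w)) \<midarrow>w\<rightarrow> deriv g w / g w"
    by (rule Lim_transform_eventually)
  then show ?thesis by (rule that)
qed

lemma DERIV_mult_exp:
  fixes f p :: "complex \<Rightarrow> complex"
  assumes "(f has_field_derivative f') (at z)" "(p has_field_derivative p') (at z)"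
  shows "((\<lambda>z. f z * exp (p z)) has_field_derivative (f' + f z * p') * exp (p z)) (at z)"
proof -
  have "((\<lambda>z. f z * exp (p z)) has_field_derivative f' * exp (p z) + exp (p z) * p' * f z) (at z)"
    by (intro DERIV_mult DERIV_fun_exp assms)
  then show ?thesis
    by (simp only: ring_distribs mult_ac)
qed

lemma proportional_if_same_logderiv:
  assumes S: "open S" "connected S" and holo: "f holomorphic_on S" "g holomorphic_on S"
    and deriv: "\<And>z. z \<in> S \<Longrightarrow> deriv f z = h z * f z" "\<And>z. z \<in> S \<Longrightarrow> deriv g z = h z * g z"
    and nonzero: "\<And>z. z \<in> S \<Longrightarrow> g z \<noteq> 0"
  obtains c where "\<And>z. z \<in> S \<Longrightarrow> f z = c * g z"
proof -
  have "((\<lambda>z. f z / g z) has_field_derivative 0) (at z)" if z: "z \<in> S" for z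
    using DERIV_divide[OF holomorphic_derivI[OF holo(1) S(1) z] holomorphic_derivI[OF holo(2) S(1) z]]
      deriv z nonzero[OF z] by simp
  then have "(\<lambda>z. f z / g z) constant_on S"
    using S by (intro has_field_derivative_0_imp_constant_on)
  then show ?thesis
    using that nonzero by (auto simp: constant_on_def divide_eq_eq)
qed

context complex_lattice
begin

lemma zeta_pole:
  assumes "\<omega> \<in> \<Lambda>"
  shows "is_pole \<zeta> \<omega>" "zorder \<zeta> \<omega> = - 1"
proof -
  let ?S = "- (\<Lambda> - {\<omega>})"
  obtain g where g: "g holomorphic_on ?S" "\<And>z. z \<notin> \<Lambda> \<Longrightarrow> \<zeta> z = 1 / (z - \<omega>) + g z"
    using zeta_simple_pole[OF assms] by blast
  let ?h = "\<lambda>z. 1 + (z - \<omega>) * g z"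
  have S: "open ?S" "\<omega> \<in> ?S"
    by (rule open_Compl_lattice_subset) auto
  have h: "?h holomorphic_on ?S"
    using g(1) by (intro holomorphic_intros)
  have zeta: "\<zeta> z = ?h z / (z - \<omega>)" if "z \<in> ?S" "z \<noteq> \<omega>" for z
    using g(2)[of z] that by (simp add: add_divide_distrib)
  show "zorder \<zeta> \<omega> = - 1"
    by (rule zorder_eqI[OF S h]) (use zeta in \<open>auto simp: power_int_minus divide_inverse\<close>)
  have "is_pole (\<lambda>z. ?h z / (z - \<omega>) ^ 1) \<omega>"
    by (rule is_pole_basic[OF h S]) auto
  moreover have "eventually (\<lambda>z. ?h z / (z - \<omega>) ^ 1 = \<zeta> z) (at \<omega>)"
    using eventually_not_in_lattice by eventually_elim (use zeta assms in force)
  ultimately show "is_pole \<zeta> \<omega>"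
    using is_pole_transform by fastforce
qed

lemma zeta_meromorphic: "\<zeta> meromorphic_on UNIV"
proof (rule meromorphic_onI_open[of _ _ \<Lambda>])
  show "\<zeta> analytic_on UNIV - \<Lambda>"
    using zeta_holomorphic open_Compl_lattice by (simp add: analytic_on_open Compl_eq_Diff_UNIV)
  show "not_essential \<zeta> \<omega>" if "\<omega> \<in> \<Lambda>" for \<omega>
    using zeta_pole(1)[OF that] by (rule is_pole_imp_not_essential)
  show "\<not> z islimpt \<Lambda> \<inter> UNIV" for z
    using lattice_sparse by (simp add: sparse_in_open)
qed simp

lemma entire_simple_zeros_lattice_exists:
  obtains f where "f holomorphic_on UNIV" "\<And>z. f z = 0 \<longleftrightarrow> z \<in> \<Lambda>" "\<And>\<omega>. \<omega> \<in> \<Lambda> \<Longrightarrow> deriv f \<omega> \<noteq> 0"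
proof -
  have isolated: "isolated_singularity_at \<zeta> z" for z
    using zeta_meromorphic meromorphic_on_isolated_singularity by (metis UNIV_I meromorphic_on_subset subset_UNIV)
  have "\<not> is_pole \<zeta> z" if "z \<notin> \<Lambda>" for z
    using not_is_pole_holomorphic[OF open_Compl_lattice _ zeta_holomorphic] that by simp
  then have pole_iff: "is_pole \<zeta> z \<longleftrightarrow> z \<in> \<Lambda>" for z
    using zeta_pole(1) by blast
  obtain f where f: "f holomorphic_on UNIV"
    and zeros: "\<And>z. f z = 0 \<longleftrightarrow> z \<in> \<Lambda>" and order: "\<And>z. z \<in> \<Lambda> \<Longrightarrow> zorder f z = 1"
    by (rule weierstrass_factorization_meromorphic_UNIV[OF remove_sings_nicely_meromorphic[OF zeta_meromorphic]])
       (simp add: isolated pole_iff zeta_pole(2))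
  have "f (\<omega>\<^sub>1 / 2) \<noteq> 0"
    using zeros half_period_not_in_lattice(1) by simp
  with f order have "deriv f \<omega> \<noteq> 0" if "\<omega> \<in> \<Lambda>" for \<omega>
    using that by (intro deriv_nonzero_at_simple_zero)
  with f zeros that show ?thesis by blast
qed

lemma zeta_diff_logderiv_limit:
  assumes f: "f holomorphic_on UNIV" and \<omega>: "\<omega> \<in> \<Lambda>" and zero: "f \<omega> = 0" "deriv f \<omega> \<noteq> 0"
  shows "\<exists>l. (\<lambda>z. \<zeta> z - deriv f z / f z) \<midarrow>\<omega>\<rightarrow> l"
proof -
  obtain l where l: "(\<lambda>z. deriv f z / f z - 1 / (z - \<omega>)) \<midarrow>\<omega>\<rightarrow> l"
    using logderiv_limit_at_simple_zero[OF f zero] by blast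
  obtain g where g: "g holomorphic_on - (\<Lambda> - {\<omega>})" "\<And>z. z \<notin> \<Lambda> \<Longrightarrow> \<zeta> z = 1 / (z - \<omega>) + g z"
    using zeta_simple_pole[OF \<omega>] by blast
  have "open (- (\<Lambda> - {\<omega>}))"
    by (rule open_Compl_lattice_subset) auto
  then have "g \<midarrow>\<omega>\<rightarrow> g \<omega>"
    using holomorphic_on_imp_continuous_on[OF g(1)] by (auto simp: continuous_on_eq_continuous_at isCont_def)
  from tendsto_diff[OF this l]
  have "(\<lambda>z. g z - (deriv f z / f z - 1 / (z - \<omega>))) \<midarrow>\<omega>\<rightarrow> g \<omega> - l" .
  moreover have "eventually (\<lambda>z. g z - (deriv f z / f z - 1 / (z - \<omega>)) = \<zeta> z - deriv f z / f z) (at \<omega>)"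
    using eventually_not_in_lattice by eventually_elim (simp add: g(2))
  ultimately have "(\<lambda>z. \<zeta> z - deriv f z / f z) \<midarrow>\<omega>\<rightarrow> g \<omega> - l"
    by (rule Lim_transform_eventually)
  then show ?thesis ..
qed

lemma zeta_eq_logderiv_plus_entire:
  assumes f: "f holomorphic_on UNIV" "\<And>z. f z = 0 \<longleftrightarrow> z \<in> \<Lambda>"
    and simple: "\<And>\<omega>. \<omega> \<in> \<Lambda> \<Longrightarrow> deriv f \<omega> \<noteq> 0"
  obtains q where "q holomorphic_on UNIV" "\<And>z. z \<notin> \<Lambda> \<Longrightarrow> \<zeta> z = deriv f z / f z + q z"
proof -
  let ?q = "\<lambda>z. \<zeta> z - deriv f z / f z"
  have holo: "?q holomorphic_on - \<Lambda>"
    using f holomorphic_deriv[OF f(1)] zeta_holomorphic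
    by (intro holomorphic_on_diff holomorphic_on_divide) (auto intro: holomorphic_on_subset)
  have lim: "\<exists>l. ?q \<midarrow>\<omega>\<rightarrow> l" if "\<omega> \<in> \<Lambda>" for \<omega>
    by (rule zeta_diff_logderiv_limit[OF f(1) that]) (use f(2) simple that in auto)
  show ?thesis
  proof
    show "remove_sings ?q holomorphic_on UNIV"
      by (rule removable_lattice_singularities(1)[OF holo]) (rule lim)
    show "\<zeta> z = deriv f z / f z + remove_sings ?q z" if "z \<notin> \<Lambda>" for z
      using removable_lattice_singularities(2)[OF holo _ that] lim by simp
  qed
qed

text \<open>The conditions determine \<open>\<sigma>\<close> uniquely.\<close>

definition sigma :: "complex \<Rightarrow> complex" ("\<sigma>") where
  "\<sigma> = (SOME s. s holomorphic_on UNIV \<and> (\<forall>z. s z = 0 \<longleftrightarrow> z \<in> \<Lambda>) \<and>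
     (\<forall>z. z \<notin> \<Lambda> \<longrightarrow> deriv s z = \<zeta> z * s z) \<and> deriv s 0 = 1)"

lemma sigma_exists:
  "\<exists>s. s holomorphic_on UNIV \<and> (\<forall>z. s z = 0 \<longleftrightarrow> z \<in> \<Lambda>) \<and>
     (\<forall>z. z \<notin> \<Lambda> \<longrightarrow> deriv s z = \<zeta> z * s z) \<and> deriv s 0 = 1"
proof -
  obtain f where f: "f holomorphic_on UNIV" "\<And>z. f z = 0 \<longleftrightarrow> z \<in> \<Lambda>"
    and simple: "\<And>\<omega>. \<omega> \<in> \<Lambda> \<Longrightarrow> deriv f \<omega> \<noteq> 0"
    using entire_simple_zeros_lattice_exists by blast
  obtain q where q: "q holomorphic_on UNIV" "\<And>z. z \<notin> \<Lambda> \<Longrightarrow> \<zeta> z = deriv f z / f z + q z"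
    using zeta_eq_logderiv_plus_entire[OF f simple] by blast
  obtain p where p: "\<And>z. (p has_field_derivative q z) (at z)"
    using holomorphic_convex_primitive'[OF convex_UNIV open_UNIV q(1)] by auto
  define s where "s = (\<lambda>z. f z * exp (p z) / (deriv f 0 * exp (p 0)))"
  have s_deriv: "(s has_field_derivative
      (deriv f z + f z * q z) * exp (p z) / (deriv f 0 * exp (p 0))) (at z)" for z
    unfolding s_def by (intro DERIV_cdivide DERIV_mult_exp p holomorphic_derivI[OF f(1)]) auto
  show ?thesis
  proof (intro exI[of _ s] conjI allI impI)
    show "s holomorphic_on UNIV"
      unfolding holomorphic_on_open[OF open_UNIV] using s_deriv by blast
    show "s z = 0 \<longleftrightarrow> z \<in> \<Lambda>" for z
      using f(2) simple[of 0] by (simp add: s_def)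
    show "deriv s z = \<zeta> z * s z" if "z \<notin> \<Lambda>" for z
    proof -
      have "deriv f z + f z * q z = \<zeta> z * f z"
        using q(2)[OF that] f(2) that by (simp add: field_simps)
      then show ?thesis
        using DERIV_imp_deriv[OF s_deriv[of z]] by (simp add: s_def)
    qed
    show "deriv s 0 = 1"
      using DERIV_imp_deriv[OF s_deriv[of 0]] f(2) simple[of 0] by simp
  qed
qed

lemma sigma_holomorphic: "\<sigma> holomorphic_on S"
  and sigma_eq_0_iff: "\<sigma> z = 0 \<longleftrightarrow> z \<in> \<Lambda>"
  and deriv_sigma: "z \<notin> \<Lambda> \<Longrightarrow> deriv \<sigma> z = \<zeta> z * \<sigma> z"
  and deriv_sigma_0: "deriv \<sigma> 0 = 1"
proof -
  note sigma = someI_ex[OF sigma_exists, folded sigma_def]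
  then show "\<sigma> z = 0 \<longleftrightarrow> z \<in> \<Lambda>" "z \<notin> \<Lambda> \<Longrightarrow> deriv \<sigma> z = \<zeta> z * \<sigma> z" "deriv \<sigma> 0 = 1"
    by simp_all
  from sigma show "\<sigma> holomorphic_on S"
    using holomorphic_on_subset by blast
qed

lemma sigma_derivative: "(\<sigma> has_field_derivative deriv \<sigma> z) (at z)"
  using holomorphic_derivI[OF sigma_holomorphic open_UNIV] by simp

lemma proportional_if_lattice_zeros:
  assumes f: "\<And>z. (f has_field_derivative f' z) (at z)" and g: "\<And>z. (g has_field_derivative g' z) (at z)"
    and logderiv: "\<And>z. z \<notin> \<Lambda> \<Longrightarrow> f' z = h z * f z" "\<And>z. z \<notin> \<Lambda> \<Longrightarrow> g' z = h z * g z"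
    and zeros: "\<And>z. f z = 0 \<longleftrightarrow> z \<in> \<Lambda>" "\<And>z. g z = 0 \<longleftrightarrow> z \<in> \<Lambda>"
  obtains c where "\<And>z. f z = c * g z"
proof -
  have holo: "f holomorphic_on - \<Lambda>" "g holomorphic_on - \<Lambda>"
    using f g open_Compl_lattice by (auto simp: holomorphic_on_open)
  obtain c where "\<And>z. z \<in> - \<Lambda> \<Longrightarrow> f z = c * g z"
    by (rule proportional_if_same_logderiv[OF open_Compl_lattice connected_Compl_lattice holo, of h])
       (use logderiv zeros DERIV_imp_deriv[OF f] DERIV_imp_deriv[OF g] in auto)
  moreover have "f z = 0 \<and> g z = 0" if "z \<in> \<Lambda>" for z
    using zeros that by blast
  ultimately show ?thesis
    using that[of c] by fastforce
qed

lemma sigma_minus: "\<sigma> (- z) = - \<sigma> z"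
proof -
  have reflected: "((\<lambda>z. \<sigma> (- z)) has_field_derivative - deriv \<sigma> (- z)) (at z)" for z
    using DERIV_chain2[of \<sigma> _ uminus, OF sigma_derivative DERIV_minus[OF DERIV_ident]] by simp
  obtain c where c: "\<And>z. \<sigma> (- z) = c * \<sigma> z"
    by (rule proportional_if_lattice_zeros[OF reflected sigma_derivative, of \<zeta>])
       (auto simp: deriv_sigma zeta_minus sigma_eq_0_iff)
  have "((\<lambda>z. c * \<sigma> z) has_field_derivative c) (at 0)"
    using DERIV_cmult[OF sigma_derivative[of 0], of c] by (simp add: deriv_sigma_0)
  moreover have "((\<lambda>z. c * \<sigma> z) has_field_derivative - 1) (at 0)"
    using reflected[of 0] by (simp add: c deriv_sigma_0)
  ultimately have "c = - 1"
    by (rule DERIV_unique)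
  with c show ?thesis by simp
qed

theorem sigma_add_lattice:
  assumes \<omega>: "\<omega> \<in> \<Lambda>" and half: "\<omega> / 2 \<notin> \<Lambda>"
  shows "\<sigma> (z + \<omega>) = - exp (eta \<omega> \<Lambda> * (z + \<omega> / 2)) * \<sigma> z"
proof -
  let ?\<epsilon> = "\<lambda>z. exp (eta \<omega> \<Lambda> * (z + \<omega> / 2))"
  have translated: "((\<lambda>z. \<sigma> (z + \<omega>)) has_field_derivative deriv \<sigma> (z + \<omega>)) (at z)" for z
    using sigma_derivative[of "z + \<omega>"] by (simp add: DERIV_shift)
  have multiplied: "((\<lambda>z. ?\<epsilon> z * \<sigma> z) has_field_derivative
      ?\<epsilon> z * (eta \<omega> \<Lambda> * \<sigma> z + deriv \<sigma> z)) (at z)" for z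
    by (auto intro!: derivative_eq_intros sigma_derivative simp: algebra_simps)
  obtain c where c: "\<And>z. \<sigma> (z + \<omega>) = c * (?\<epsilon> z * \<sigma> z)"
    by (rule proportional_if_lattice_zeros[OF translated multiplied, of "\<lambda>z. \<zeta> z + eta \<omega> \<Lambda>"])
       (use \<omega> in \<open>auto simp: deriv_sigma zeta_add_lattice sigma_eq_0_iff algebra_simps\<close>)
  have "\<sigma> (\<omega> / 2) = - c * \<sigma> (\<omega> / 2)"
    using c[of "- (\<omega> / 2)"] by (simp add: sigma_minus)
  then have "- c = 1"
    using half by (metis mult_cancel_right2 sigma_eq_0_iff)
  then have "c = - 1"
    by (simp add: minus_equation_iff)
  with c show ?thesis by simp
qed

theorem quasi_periodic_eq_sigma_power:
  assumes entire: "f holomorphic_on UNIV"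
    and period1: "\<And>z. f (z + \<omega>\<^sub>1) = (- exp (eta \<omega>\<^sub>1 \<Lambda> * (z + \<omega>\<^sub>1 / 2))) ^ n * f z"
    and period2: "\<And>z. f (z + \<omega>\<^sub>2) = (- exp (eta \<omega>\<^sub>2 \<Lambda> * (z + \<omega>\<^sub>2 / 2))) ^ n * f z"
    and order: "\<And>i. i < n \<Longrightarrow> (deriv ^^ i) f 0 = 0"
  shows "f z = (deriv ^^ n) f 0 / fact n * \<sigma> z ^ n"
proof -
  obtain g where g: "g holomorphic_on UNIV" "\<And>z. f z = z ^ n * g z"
    using entire_divide_power[OF entire order] by auto
  have "g 0 = (deriv ^^ n) f 0 / fact n"
    using higher_deriv_power_mult[OF g(1), of n 0] by (simp flip: g(2))
  obtain t where t: "t holomorphic_on UNIV" "\<And>z. \<sigma> z = z * t z" "t 0 = 1"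
    using entire_divide_linear[OF sigma_holomorphic, of 0] by (auto simp: sigma_eq_0_iff deriv_sigma_0)
  let ?h = "\<lambda>z. f z / \<sigma> z ^ n"
  have "((\<lambda>z. g z / t z ^ n) \<longlongrightarrow> g 0 / t 0 ^ n) (at 0)"
    by (intro tendsto_intros entire_tendsto g t) (simp add: t(3))
  moreover have "eventually (\<lambda>z. g z / t z ^ n = ?h z) (at 0)"
    by (auto simp: eventually_at_filter g(2) t(2) power_mult_distrib)
  ultimately have lim: "?h \<midarrow>0\<rightarrow> g 0"
    unfolding t(3) using Lim_transform_eventually by fastforce
  have holo: "?h holomorphic_on - \<Lambda>"
    using entire sigma_holomorphic sigma_eq_0_iff
    by (intro holomorphic_on_divide holomorphic_on_power) (auto intro: holomorphic_on_subset)
  have periodic: "?h (z + \<omega>) = ?h z"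
    if "\<omega> \<in> \<Lambda>" "\<omega> / 2 \<notin> \<Lambda>" "\<And>z. f (z + \<omega>) = (- exp (eta \<omega> \<Lambda> * (z + \<omega> / 2))) ^ n * f z" for \<omega> z
    unfolding that(3) sigma_add_lattice[OF that(1,2)] power_mult_distrib
    by (rule mult_divide_mult_cancel_left) simp
  have "?h z = g 0" if "z \<notin> \<Lambda>" for z
    by (rule elliptic_constant[OF holo periodic[OF _ _ period1] periodic[OF _ _ period2] lim that])
       (simp_all add: half_period_not_in_lattice)
  then have off_lattice: "f z = g 0 * \<sigma> z ^ n" if "z \<in> - \<Lambda>" for z
    using that by (simp add: sigma_eq_0_iff divide_eq_eq)
  have "f z = g 0 * \<sigma> z ^ n"
    by (rule analytic_continuation_open[OF open_Compl_lattice open_UNIV _ connected_UNIV _ _ _ off_lattice])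
       (use half_period_not_in_lattice(1) in \<open>auto intro!: holomorphic_intros entire sigma_holomorphic\<close>)
  with \<open>g 0 = _\<close> show ?thesis by simp
qed

end

section \<open>Modular forms of nonpositive weight\<close>

lemma e_add: "e (x + y) = e x * e y"
  by (simp add: e_def exp_add algebra_simps)

lemma e_of_int [simp]: "e (of_int n) = 1"
  unfolding e_def exp_eq_1 by (auto simp: mult_ac)

lemma e_nonzero [simp]: "e z \<noteq> 0"
  by (simp add: e_def)

lemma norm_e: "norm (e z) = exp (- 2 * pi * Im z)"
  by (simp add: e_def)

lemma norm_e_less_1: "\<tau> \<in> upper_half_plane \<Longrightarrow> norm (e \<tau>) < 1"
  by (simp add: norm_e upper_half_plane_def)

lemma e_holomorphic [holomorphic_intros]: "f holomorphic_on S \<Longrightarrow> (\<lambda>z. e (f z)) holomorphic_on S"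
  unfolding e_def by (intro holomorphic_intros)

lemma e_preimage_in_strip:
  assumes "w \<noteq> 0" "norm w < 1"
  obtains \<tau> where "\<tau> \<in> upper_half_plane" "e \<tau> = w" "\<bar>Re \<tau>\<bar> \<le> 1"
proof
  let ?t = "Ln w / (2 * of_real pi * \<i>)"
  let ?\<tau> = "?t - of_int \<lfloor>Re ?t\<rfloor>"
  have "e ?t = w" using assms(1) by (simp add: e_def)
  then show e: "e ?\<tau> = w"
    using e_add[of ?\<tau> "of_int \<lfloor>Re ?t\<rfloor>"] by simp
  have "exp (- 2 * pi * Im ?\<tau>) < 1" using norm_e[of ?\<tau>] e assms(2) by simp
  then have "2 * pi * Im ?\<tau> > 0" by simp
  then show "?\<tau> \<in> upper_half_plane" unfolding upper_half_plane_def by (simp add: zero_less_mult_iff)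
  show "\<bar>Re ?\<tau>\<bar> \<le> 1" using floor_correct[of "Re ?t"] by simp linarith
qed

context complex_lattice
begin

lemma shortest_lattice_vector:
  obtains \<omega> where "\<omega> \<in> \<Lambda>" "\<omega> \<noteq> 0" "\<forall>\<omega>'\<in>\<Lambda> - {0}. norm \<omega> \<le> norm \<omega>'"
proof -
  let ?S = "\<Lambda> \<inter> cball 0 (norm \<omega>\<^sub>1) - {0}"
  have fin: "finite ?S" using finite_lattice_cball by simp
  have "\<omega>\<^sub>1 \<in> ?S" using independent_periods by auto
  then have "?S \<noteq> {}" by blast
  define \<omega> where "\<omega> = arg_min_on norm ?S"
  have \<omega>: "\<omega> \<in> ?S" "\<And>\<omega>'. \<omega>' \<in> ?S \<Longrightarrow> norm \<omega> \<le> norm \<omega>'"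
    using arg_min_if_finite[OF fin \<open>?S \<noteq> {}\<close>, of norm] by (auto simp: \<omega>_def not_less)
  have "norm \<omega> \<le> norm \<omega>'" if "\<omega>' \<in> \<Lambda>" "\<omega>' \<noteq> 0" for \<omega>'
    using \<omega>(1) \<omega>(2)[of \<omega>'] that by (cases "\<omega>' \<in> ?S") auto
  then show ?thesis using that \<omega>(1) by blast
qed

lemma shortest_lattice_vector_coprime:
  obtains c d :: int where "coprime c d"
    "\<forall>\<omega>\<in>\<Lambda> - {0}. norm (of_int c * \<omega>\<^sub>1 + of_int d * \<omega>\<^sub>2) \<le> norm \<omega>"
proof -
  obtain c d :: int where nonzero: "of_int c * \<omega>\<^sub>1 + of_int d * \<omega>\<^sub>2 \<noteq> 0"
    and shortest: "\<forall>\<omega>\<in>\<Lambda> - {0}. norm (of_int c * \<omega>\<^sub>1 + of_int d * \<omega>\<^sub>2) \<le> norm \<omega>"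
    using shortest_lattice_vector by (metis lattice_iff)
  define g where "g = gcd c d"
  obtain c' d' where cd: "c = g * c'" "d = g * d'"
    unfolding g_def by (meson dvdE gcd_dvd1 gcd_dvd2)
  let ?\<omega> = "of_int c' * \<omega>\<^sub>1 + of_int d' * \<omega>\<^sub>2"
  have multiple: "of_int c * \<omega>\<^sub>1 + of_int d * \<omega>\<^sub>2 = of_int g * ?\<omega>"
    by (simp add: cd algebra_simps)
  have "g > 0" and "?\<omega> \<noteq> 0"
    using nonzero multiple by (auto simp: g_def gcd_pos_int intro!: gr0I)
  then have "of_int g * norm ?\<omega> \<le> 1 * norm ?\<omega>"
    using bspec[OF shortest, of ?\<omega>] unfolding multiple by (simp add: norm_mult)
  then have "real_of_int g \<le> 1"
    using \<open>?\<omega> \<noteq> 0\<close> by (subst (asm) mult_le_cancel_right_pos) auto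
  then have "g \<le> 1" by simp
  with \<open>g > 0\<close> have "g = 1" by linarith
  then have "coprime c d"
    by (simp add: g_def coprime_iff_gcd_eq_1)
  with shortest that show ?thesis by blast
qed

end

lemma complex_lattice_upper_half_plane: "\<tau> \<in> upper_half_plane \<Longrightarrow> complex_lattice \<tau> 1"
  by unfold_locales (simp add: upper_half_plane_def)

definition moebius :: "int \<Rightarrow> int \<Rightarrow> int \<Rightarrow> int \<Rightarrow> complex \<Rightarrow> complex" where
  "moebius a b c d \<tau> = (of_int a * \<tau> + of_int b) / (of_int c * \<tau> + of_int d)"

lemma moebius_denominator_nonzero:
  fixes a b c d :: int
  assumes "a * d - b * c = 1" "\<tau> \<in> upper_half_plane"
  shows "of_int c * \<tau> + of_int d \<noteq> 0"
proof
  assume zero: "of_int c * \<tau> + of_int d = 0"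
  from arg_cong[OF zero, of Im] assms(2) have "c = 0" by (simp add: upper_half_plane_def)
  with zero assms(1) show False by simp
qed

lemma Im_moebius:
  fixes a b c d :: int
  assumes "a * d - b * c = 1" "\<tau> \<in> upper_half_plane"
  shows "Im (moebius a b c d \<tau>) = Im \<tau> / norm (of_int c * \<tau> + of_int d) ^ 2"
proof -
  have det: "real_of_int a * real_of_int d - real_of_int b * real_of_int c = 1"
    using arg_cong[OF assms(1), of real_of_int] by simp
  have "Im ((of_int a * \<tau> + of_int b) * cnj (of_int c * \<tau> + of_int d)) =
      (real_of_int a * real_of_int d - real_of_int b * real_of_int c) * Im \<tau>"
    by (simp add: algebra_simps)
  then show ?thesis
    unfolding moebius_def det by (subst complex_div_cnj) (simp add: det)
qed

lemma moebius_in_upper_half_plane: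
  fixes a b c d :: int
  assumes "a * d - b * c = 1" "\<tau> \<in> upper_half_plane"
  shows "moebius a b c d \<tau> \<in> upper_half_plane"
  using assms(2) Im_moebius[OF assms] moebius_denominator_nonzero[OF assms] by (simp add: upper_half_plane_def)

lemma Im_ge_half_if_reduced:
  assumes "z \<in> upper_half_plane" "norm z \<ge> 1" "\<bar>Re z\<bar> \<le> 1 / 2"
  shows "Im z \<ge> 1 / 2"
proof -
  have "1\<^sup>2 \<le> norm z ^ 2" using assms(2) by (intro power_mono) auto
  then have "1 \<le> (Re z)\<^sup>2 + (Im z)\<^sup>2" by (simp add: cmod_power2)
  moreover have "(Re z)\<^sup>2 \<le> (1 / 2)\<^sup>2" using assms(3) by (intro abs_le_square_iff[THEN iffD1]) simp
  ultimately have "(1 / 2)\<^sup>2 \<le> (Im z)\<^sup>2" by (simp add: power2_eq_square)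
  then show ?thesis
    using assms(1) by (intro power2_le_imp_le[of "1 / 2"]) (auto simp: upper_half_plane_def)
qed

text \<open>The denominator \<open>c \<tau> + d\<close> is a shortest vector of \<open>[\<tau>, 1]\<close>, so the numerator is at least as long.\<close>

lemma exists_moebius_Im_ge_half:
  assumes \<tau>: "\<tau> \<in> upper_half_plane"
  obtains a b c d :: int where "a * d - b * c = 1" "Im (moebius a b c d \<tau>) \<ge> 1 / 2"
proof -
  interpret complex_lattice \<tau> 1 by (rule complex_lattice_upper_half_plane[OF \<tau>])
  obtain c d :: int where coprime: "coprime c d"
    and shortest: "\<forall>\<omega>\<in>lattice \<tau> 1 - {0}. norm (of_int c * \<tau> + of_int d) \<le> norm \<omega>"
    using shortest_lattice_vector_coprime unfolding mult_1_right .
  obtain u v where uv: "u * c + v * d = 1"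
    using bezout_int[of c d] coprime by (metis coprime_iff_gcd_eq_1)
  define n where "n = round (Re (moebius v (- u) c d \<tau>))"
  define a b where "a = v - n * c" and "b = - u - n * d"
  have det: "a * d - b * c = 1" using uv by (simp add: a_def b_def algebra_simps)
  note denominator = moebius_denominator_nonzero[OF det \<tau>]
  have numerator: "of_int a * \<tau> + of_int b \<noteq> 0"
    using moebius_in_upper_half_plane[OF det \<tau>] by (auto simp: moebius_def upper_half_plane_def)
  have "of_int a * \<tau> + of_int b \<in> lattice \<tau> 1 - {0}"
    using of_int_combination_in_lattice[of a b] numerator by simp
  from bspec[OF shortest this] have "norm (moebius a b c d \<tau>) \<ge> 1"
    using denominator by (simp add: moebius_def norm_divide)
  moreover have "moebius a b c d \<tau> = moebius v (- u) c d \<tau> - of_int n"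
    using denominator by (simp add: moebius_def a_def b_def field_simps)
  then have "\<bar>Re (moebius a b c d \<tau>)\<bar> \<le> 1 / 2"
    using of_int_round_abs_le[of "Re (moebius v (- u) c d \<tau>)"] by (simp add: n_def abs_minus_commute)
  ultimately have "Im (moebius a b c d \<tau>) \<ge> 1 / 2"
    by (intro Im_ge_half_if_reduced moebius_in_upper_half_plane[OF det \<tau>])
  with det that show ?thesis by blast
qed

locale nonpos_weight_form =
  fixes f g :: "complex \<Rightarrow> complex" and n :: nat
  assumes modular: "\<And>a b c d \<tau>. a * d - b * c = 1 \<Longrightarrow> \<tau> \<in> upper_half_plane \<Longrightarrow>
      f (moebius a b c d \<tau>) * (of_int c * \<tau> + of_int d) ^ n = f \<tau>"
    and holomorphic: "g holomorphic_on ball 0 1"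
    and q_expansion: "\<And>\<tau>. \<tau> \<in> upper_half_plane \<Longrightarrow> f \<tau> = g (e \<tau>)"
begin

lemma growth_bound:
  assumes B: "\<And>\<tau>. Im \<tau> \<ge> 1 / 2 \<Longrightarrow> norm (f \<tau>) \<le> B" and \<tau>: "\<tau> \<in> upper_half_plane"
  shows "norm (f \<tau>) ^ 2 \<le> B\<^sup>2 * (2 * Im \<tau>) ^ n"
proof -
  obtain a b c d :: int where det: "a * d - b * c = 1" and half: "Im (moebius a b c d \<tau>) \<ge> 1 / 2"
    by (rule exists_moebius_Im_ge_half[OF \<tau>])
  let ?w = "of_int c * \<tau> + of_int d"
  have w: "norm ?w ^ 2 \<le> 2 * Im \<tau>"
    using half moebius_denominator_nonzero[OF det \<tau>] unfolding Im_moebius[OF det \<tau>] by (simp add: field_simps)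
  have "norm (f \<tau>) = norm (f (moebius a b c d \<tau>)) * norm ?w ^ n"
    using modular[OF det \<tau>] by (metis norm_mult norm_power)
  also have "\<dots> \<le> B * norm ?w ^ n"
    using B[OF half] by (intro mult_right_mono) auto
  finally have "norm (f \<tau>) ^ 2 \<le> (B * norm ?w ^ n) ^ 2" by (intro power_mono) auto
  also have "\<dots> = B\<^sup>2 * (norm ?w ^ 2) ^ n"
    by (simp add: power_mult_distrib power_mult[symmetric] mult.commute)
  also have "\<dots> \<le> B\<^sup>2 * (2 * Im \<tau>) ^ n"
    using w by (intro mult_left_mono power_mono) auto
  finally show ?thesis .
qed

lemma maximum_on_fundamental_disc:
  obtains x where "x \<in> ball 0 1" "norm (g 0) \<le> norm (g x)"
    "\<forall>\<tau>\<in>upper_half_plane. norm (f \<tau>) ^ 2 \<le> norm (g x) ^ 2 * (2 * Im \<tau>) ^ n"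
proof -
  let ?D = "cball 0 (exp (- pi)) :: complex set"
  have disc: "?D \<subseteq> ball 0 1"
    by (simp add: cball_subset_ball_iff)
  have "continuous_on ?D (\<lambda>q. norm (g q))"
    using holomorphic_on_imp_continuous_on[OF holomorphic_on_subset[OF holomorphic disc]]
    by (rule continuous_on_norm)
  then obtain x where x: "x \<in> ?D" "\<And>q. q \<in> ?D \<Longrightarrow> norm (g q) \<le> norm (g x)"
    using continuous_attains_sup[OF compact_cball, of 0 "exp (- pi)"] by force
  have "norm (f \<tau>) \<le> norm (g x)" if "Im \<tau> \<ge> 1 / 2" for \<tau>
    using x(2)[of "e \<tau>"] q_expansion[of \<tau>] that by (simp add: norm_e upper_half_plane_def)
  then show ?thesis
    using that[of x] growth_bound x disc by auto
qed

theorem weight_0_constant: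
  assumes "n = 0" "\<tau> \<in> upper_half_plane" "\<tau>' \<in> upper_half_plane"
  shows "f \<tau> = f \<tau>'"
proof -
  obtain x where x: "x \<in> ball 0 1" "norm (g 0) \<le> norm (g x)"
    and bound: "\<forall>\<tau>\<in>upper_half_plane. norm (f \<tau>) ^ 2 \<le> norm (g x) ^ 2 * (2 * Im \<tau>) ^ n"
    using maximum_on_fundamental_disc .
  have "norm (g q) \<le> norm (g x)" if q: "q \<in> ball 0 1" for q
  proof (cases "q = 0")
    case False
    then obtain t where t: "t \<in> upper_half_plane" "e t = q"
      using e_preimage_in_strip[of q] q by auto
    have "norm (g q) ^ 2 \<le> norm (g x) ^ 2"
      using bound t(1) q_expansion[OF t(1)] t(2) assms(1) by fastforce
    then show ?thesis by (rule power2_le_imp_le) simp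
  qed (use x in simp)
  then have "g constant_on ball 0 1"
    by (intro maximum_modulus_principle[OF holomorphic, of "ball 0 1" x]) (use x in auto)
  then show ?thesis
    using assms norm_e_less_1 by (auto simp: constant_on_def q_expansion)
qed

lemma norm_le_by_maximum_modulus:
  assumes bound: "\<forall>\<tau>\<in>upper_half_plane. norm (f \<tau>) ^ 2 \<le> B\<^sup>2 * (2 * Im \<tau>) ^ n"
    and y: "0 < y" "y \<le> Im \<tau>"
  shows "norm (f \<tau>) \<le> sqrt (B\<^sup>2 * (2 * y) ^ n)"
proof -
  let ?r = "exp (- 2 * pi * y)"
  have r: "?r < 1" using y by simp
  then have disc: "cball 0 ?r \<subseteq> (ball 0 1 :: complex set)" by (simp add: cball_subset_ball_iff)
  have "norm (g (e \<tau>)) \<le> sqrt (B\<^sup>2 * (2 * y) ^ n)"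
  proof (rule maximum_modulus_frontier[of g "cball 0 ?r"])
    show "g holomorphic_on interior (cball 0 ?r)"
      by (rule holomorphic_on_subset[OF holomorphic order.trans[OF interior_subset disc]])
    show "continuous_on (closure (cball 0 ?r)) g"
      using holomorphic_on_imp_continuous_on[OF holomorphic_on_subset[OF holomorphic disc]] by simp
    show "e \<tau> \<in> cball 0 ?r" using y by (simp add: norm_e)
    fix q assume "q \<in> frontier (cball 0 ?r :: complex set)"
    then have q: "norm q = ?r" by (simp add: frontier_cball)
    then have "q \<noteq> 0" "norm q < 1" using r by (auto simp del: exp_less_one_iff)
    then obtain t where t: "t \<in> upper_half_plane" "e t = q" using e_preimage_in_strip by blast
    have "Im t = y" using norm_e[of t] t(2) q by simp
    then show "norm (g q) \<le> sqrt (B\<^sup>2 * (2 * y) ^ n)"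
      using bspec[OF bound t(1)] q_expansion[OF t(1)] t(2) by (intro real_le_rsqrt) simp
  qed auto
  then show ?thesis
    using q_expansion[of \<tau>] y by (simp add: upper_half_plane_def)
qed

theorem negative_weight_zero:
  assumes "n > 0" "\<tau> \<in> upper_half_plane"
  shows "f \<tau> = 0"
proof -
  obtain x where bound: "\<forall>\<tau>\<in>upper_half_plane. norm (f \<tau>) ^ 2 \<le> norm (g x) ^ 2 * (2 * Im \<tau>) ^ n"
    using maximum_on_fundamental_disc .
  let ?b = "\<lambda>y. sqrt (norm (g x) ^ 2 * (2 * y) ^ n)"
  have "(?b \<longlongrightarrow> sqrt (norm (g x) ^ 2 * (2 * 0) ^ n)) (at_right 0)"
    by (intro tendsto_intros)
  then have "(?b \<longlongrightarrow> 0) (at_right 0)"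
    using assms(1) by (simp add: zero_power)
  moreover have "eventually (\<lambda>y. norm (f \<tau>) \<le> ?b y) (at_right 0)"
    using norm_le_by_maximum_modulus[OF bound] assms(2)
    unfolding eventually_at_right_field upper_half_plane_def by (intro exI[of _ "Im \<tau>"]) auto
  ultimately have "norm (f \<tau>) \<le> 0"
    by (rule tendsto_lowerbound) simp
  then show ?thesis by simp
qed

end

section \<open>Taylor coefficients of power series with holomorphic coefficients\<close>

lemma power_series_coeff_bound:
  fixes a :: "nat \<Rightarrow> complex"
  assumes sums: "\<And>w. w \<in> ball 0 1 \<Longrightarrow> (\<lambda>n. a n * w ^ n) sums h w"
    and r: "0 < r" "r < 1" and M: "\<And>w. norm w = r \<Longrightarrow> norm (h w) \<le> M"
  shows "norm (a n) \<le> M / r ^ n"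
proof -
  have holo: "h holomorphic_on ball 0 1"
    by (rule power_series_holomorphic[of 0 1 a]) (use sums in auto)
  have disc: "cball 0 r \<subseteq> (ball 0 1 :: complex set)"
    using r by (simp add: cball_subset_ball_iff)
  have "h has_fps_expansion Abs_fps a"
    using eventually_nhds_in_open[of "ball 0 1" "0::complex"] sums
    by (intro has_fps_expansionI) (auto elim!: eventually_mono)
  then have "a n = (deriv ^^ n) h 0 / fact n"
    using fps_nth_fps_expansion by fastforce
  moreover have "norm ((deriv ^^ n) h 0) \<le> fact n * M / r ^ n"
    by (rule Cauchy_inequality)
       (use r M holomorphic_on_subset[OF holo disc] in
        \<open>auto intro: holomorphic_on_imp_continuous_on holomorphic_on_subset\<close>)
  then have "norm ((deriv ^^ n) h 0) / fact n \<le> fact n * M / r ^ n / fact n"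
    by (rule divide_right_mono) simp
  ultimately show ?thesis by (simp add: norm_divide)
qed

context
  fixes P :: "nat \<Rightarrow> complex \<Rightarrow> complex" and G :: "complex \<Rightarrow> complex \<Rightarrow> complex"
  assumes P: "\<And>n. P n holomorphic_on UNIV"
    and sums: "\<And>w z. w \<in> ball 0 1 \<Longrightarrow> (\<lambda>n. P n z * w ^ n) sums G w z"
    and bound: "\<And>r. 0 < r \<Longrightarrow> r < 1 \<Longrightarrow> \<exists>M. \<forall>w z. norm w = r \<longrightarrow> norm z \<le> 1 \<longrightarrow> norm (G w z) \<le> M"
begin

lemma higher_deriv_power_series_sums:
  assumes w: "w \<in> ball 0 1"
  shows "(\<lambda>n. (deriv ^^ j) (P n) 0 * w ^ n) sums (deriv ^^ j) (G w) 0"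
proof -
  define r where "r = (1 + norm w) / 2"
  have r: "0 < r" "r < 1" "norm w < r" using w by (auto simp: r_def intro: add_pos_nonneg)
  obtain M where M: "\<And>w z. norm w = r \<Longrightarrow> norm z \<le> 1 \<Longrightarrow> norm (G w z) \<le> M"
    using bound[OF r(1,2)] by blast
  have "uniform_limit (ball 0 1) (\<lambda>N z. \<Sum>n<N. P n z * w ^ n) (\<lambda>z. \<Sum>n. P n z * w ^ n) sequentially"
  proof (rule Weierstrass_m_test)
    fix n and z :: complex assume "z \<in> ball 0 1"
    then have "norm (P n z) \<le> M / r ^ n"
      by (intro power_series_coeff_bound[of "\<lambda>n. P n z" "\<lambda>w. G w z"] sums r M) auto
    then have "norm (P n z) * norm w ^ n \<le> M / r ^ n * norm w ^ n"
      by (rule mult_right_mono) simp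
    then show "norm (P n z * w ^ n) \<le> M * (norm w / r) ^ n"
      by (simp add: norm_mult norm_power power_divide)
  next
    show "summable (\<lambda>n. M * (norm w / r) ^ n)"
      using r by (intro summable_mult summable_geometric) auto
  qed
  moreover have "(\<lambda>z. \<Sum>n. P n z * w ^ n) = G w"
    using sums[OF w] by (auto simp: sums_iff)
  ultimately have "uniform_limit (ball 0 1) (\<lambda>N z. \<Sum>n<N. P n z * w ^ n) (G w) sequentially"
    by simp
  then have "(\<lambda>N. (deriv ^^ j) (\<lambda>z. \<Sum>n<N. P n z * w ^ n) 0) \<longlonglongrightarrow> (deriv ^^ j) (G w) 0"
    by (rule higher_deriv_complex_uniform_limit)
       (auto intro!: always_eventually holomorphic_intros holomorphic_on_subset[OF P])
  moreover have "(deriv ^^ j) (\<lambda>z. \<Sum>n<N. P n z * w ^ n) 0 = (\<Sum>n<N. (deriv ^^ j) (P n) 0 * w ^ n)" for N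
  proof -
    have "(deriv ^^ j) (\<lambda>z. P n z * w ^ n) 0 = (deriv ^^ j) (P n) 0 * w ^ n" for n
      using higher_deriv_cmult[OF P UNIV_I open_UNIV, of j "w ^ n" n 0] by (simp add: mult.commute)
    then show ?thesis
      by (subst higher_deriv_sum[OF open_UNIV]) (auto intro!: holomorphic_intros P)
  qed
  ultimately show ?thesis
    by (simp add: sums_def)
qed

lemma higher_deriv_power_series_holomorphic: "(\<lambda>w. (deriv ^^ j) (G w) 0) holomorphic_on ball 0 1"
  by (rule power_series_holomorphic[of 0 1 "\<lambda>n. (deriv ^^ j) (P n) 0"]) (use higher_deriv_power_series_sums in simp)

end

lemma q_series_sums_on_disc:
  fixes F :: "complex \<Rightarrow> complex" and a :: "nat \<Rightarrow> complex"
  assumes sums: "\<And>\<tau>. \<tau> \<in> upper_half_plane \<Longrightarrow> (\<lambda>n. a n * e \<tau> ^ n) sums F \<tau>" and w: "w \<in> ball 0 1"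
  shows "(\<lambda>n. a n * w ^ n) sums (\<Sum>n. a n * w ^ n)"
proof (cases "w = 0")
  case False
  then obtain t where "t \<in> upper_half_plane" "e t = w"
    using w e_preimage_in_strip[of w] by auto
  then show ?thesis
    using sums by (metis sums_summable summable_sums)
qed (simp add: powser_sums_zero)

lemma higher_deriv_q_expansion:
  fixes F :: "complex \<Rightarrow> complex \<Rightarrow> complex" and P :: "nat \<Rightarrow> complex \<Rightarrow> complex"
  assumes P: "\<And>n. P n holomorphic_on UNIV"
    and sums: "\<And>\<tau> z. \<tau> \<in> upper_half_plane \<Longrightarrow> (\<lambda>n. P n z * e \<tau> ^ n) sums F \<tau> z"
    and bound: "\<And>y. y > 0 \<Longrightarrow>
      \<exists>M. \<forall>\<tau> z. Im \<tau> = y \<longrightarrow> \<bar>Re \<tau>\<bar> \<le> 1 \<longrightarrow> norm z \<le> 1 \<longrightarrow> norm (F \<tau> z) \<le> M"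
  obtains g where "g holomorphic_on ball 0 1"
    "\<And>\<tau>. \<tau> \<in> upper_half_plane \<Longrightarrow> (deriv ^^ j) (F \<tau>) 0 = g (e \<tau>)"
proof
  define G where "G = (\<lambda>w z. \<Sum>n. P n z * w ^ n)"
  have G_e: "G (e \<tau>) = F \<tau>" if "\<tau> \<in> upper_half_plane" for \<tau>
    using sums[OF that] by (auto simp: G_def sums_iff)
  then show "(deriv ^^ j) (F \<tau>) 0 = (deriv ^^ j) (G (e \<tau>)) 0" if "\<tau> \<in> upper_half_plane" for \<tau>
    using that by simp
  have G_bounded: "\<exists>M. \<forall>w z. norm w = r \<longrightarrow> norm z \<le> 1 \<longrightarrow> norm (G w z) \<le> M" if r: "0 < r" "r < 1" for r
  proof -
    have "- ln r / (2 * pi) > 0" using r by (intro divide_pos_pos) auto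
    then obtain M where M: "\<And>\<tau> z. Im \<tau> = - ln r / (2 * pi) \<Longrightarrow> \<bar>Re \<tau>\<bar> \<le> 1 \<Longrightarrow> norm z \<le> 1 \<Longrightarrow>
        norm (F \<tau> z) \<le> M"
      using bound by meson
    have "norm (G w z) \<le> M" if w: "norm w = r" and z: "norm z \<le> 1" for w z
    proof -
      obtain t where t: "t \<in> upper_half_plane" "e t = w" "\<bar>Re t\<bar> \<le> 1"
        using e_preimage_in_strip[of w] w r by (metis less_irrefl norm_zero)
      have "ln r = - 2 * pi * Im t" using norm_e[of t] t(2) w by simp
      then have "Im t = - ln r / (2 * pi)" by simp
      then show ?thesis using M t z G_e by metis
    qed
    then show ?thesis by blast
  qed
  show "(\<lambda>w. (deriv ^^ j) (G w) 0) holomorphic_on ball 0 1"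
    by (rule higher_deriv_power_series_holomorphic[OF P _ G_bounded])
       (use q_series_sums_on_disc[OF sums] in \<open>simp_all add: G_def\<close>)
qed

section \<open>Taylor coefficients of Jacobi forms of negative weight\<close>

lemma (in complex_lattice) psi_eq_minus_1:
  assumes "\<omega> \<in> \<Lambda>" "\<omega> / 2 \<notin> \<Lambda>"
  shows "psi \<omega> \<Lambda> = - 1"
proof -
  have "\<omega> \<notin> (\<lambda>w. 2 * w) ` \<Lambda>"
    using assms(2) by auto
  with assms(1) show ?thesis by (simp add: psi_def)
qed

lemma holomorphic2_on_section:
  assumes holo: "holomorphic2_on f (A \<times> UNIV)" and "open A" "x \<in> A"
  shows "(\<lambda>z. f (x, z)) holomorphic_on S"
proof -
  have "(\<lambda>z. f (x, z)) holomorphic_on UNIV"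
    unfolding holomorphic_on_open[OF open_UNIV]
  proof
    fix z :: complex
    obtain a b where "(f has_derivative (\<lambda>h. a * fst h + b * snd h)) (at (x, z) within A \<times> UNIV)"
      using holo \<open>x \<in> A\<close> unfolding holomorphic2_on_def by blast
    then have "(f has_derivative (\<lambda>h. a * fst h + b * snd h)) (at (x, z))"
      using at_within_open[of "(x, z)", OF _ open_Times[OF \<open>open A\<close> open_UNIV]] \<open>x \<in> A\<close> by simp
    moreover have "((\<lambda>z. (x, z)) has_derivative (\<lambda>h. (0, h))) (at z)"
      by (auto intro!: derivative_eq_intros)
    ultimately have "((\<lambda>z. f (x, z)) has_derivative (\<lambda>h. a * fst (0::complex, h) + b * snd (0::complex, h))) (at z)"
      using has_derivative_compose by blast
    then have "((\<lambda>z. f (x, z)) has_field_derivative b) (at z)"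
      by (simp add: has_field_derivative_def)
    then show "\<exists>f'. ((\<lambda>z. f (x, z)) has_field_derivative f') (at z)" by blast
  qed
  then show ?thesis by (rule holomorphic_on_subset) simp
qed

lemma open_upper_half_plane: "open upper_half_plane"
  unfolding upper_half_plane_def by (rule open_halfspace_Im_gt)

lemma q_series_abs_summable:
  assumes summable: "\<And>\<tau>. \<tau> \<in> upper_half_plane \<Longrightarrow> summable (\<lambda>n. a n * e \<tau> ^ n)" and \<tau>: "\<tau> \<in> upper_half_plane"
  shows "summable (\<lambda>n. norm (a n * e \<tau> ^ n))"
proof -
  define t where "t = Complex (Re \<tau>) (Im \<tau> / 2)"
  have "t \<in> upper_half_plane" "norm (e \<tau>) < norm (e t)"
    using \<tau> by (simp_all add: t_def upper_half_plane_def norm_e)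
  then show ?thesis
    using powser_insidea[OF summable] by blast
qed

locale jacobi_form =
  fixes \<phi> :: "complex \<times> complex \<Rightarrow> complex" and K :: nat
  assumes in_J_space: "\<phi> \<in> J_space (- int K)"
begin

lemma continuous: "continuous_on (upper_half_plane \<times> UNIV) \<phi>"
  using in_J_space unfolding J_space_def holomorphic2_on_def
  by (auto simp: continuous_on_eq_continuous_within dest!: bspec intro: has_derivative_continuous)

lemma entire: "\<tau> \<in> upper_half_plane \<Longrightarrow> (\<lambda>z. \<phi> (\<tau>, z)) holomorphic_on S"
  using in_J_space by (intro holomorphic2_on_section[OF _ open_upper_half_plane]) (simp_all add: J_space_def)

lemma modular:
  assumes det: "a * d - b * c = 1" and \<tau>: "\<tau> \<in> upper_half_plane"
  shows "\<phi> (\<tau>, z) = (of_int c * \<tau> + of_int d) ^ K * \<phi> (moebius a b c d \<tau>, z / (of_int c * \<tau> + of_int d))"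
proof -
  define M :: "int^2^2" where "M = vector [vector [a, b], vector [c, d]]"
  have M: "M $ 1 $ 1 = a" "M $ 1 $ 2 = b" "M $ 2 $ 1 = c" "M $ 2 $ 2 = d"
    by (simp_all add: M_def)
  have "M \<in> SL2Z" using det by (simp add: SL2Z_def det_2 M)
  then have "slash_mat \<phi> (- int K) M (\<tau>, z) = \<phi> (\<tau>, z)"
    using in_J_space \<tau> by (auto simp: J_space_def)
  then show ?thesis by (simp add: slash_mat_def M Let_def moebius_def)
qed

lemma quasi_periodic:
  assumes \<tau>: "\<tau> \<in> upper_half_plane" and \<omega>: "\<omega> \<in> lattice \<tau> 1" "\<omega> / 2 \<notin> lattice \<tau> 1"
  shows "\<phi> (\<tau>, z + \<omega>) = (- exp (eta \<omega> (lattice \<tau> 1) * (z + \<omega> / 2))) ^ K * \<phi> (\<tau>, z)"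
proof -
  interpret complex_lattice \<tau> 1 by (rule complex_lattice_upper_half_plane[OF \<tau>])
  let ?w = "- exp (eta \<omega> (lattice \<tau> 1) * (z + \<omega> / 2))"
  obtain a b :: int where "\<omega> = of_int a * \<tau> + of_int b"
    using \<omega>(1) unfolding lattice_iff by auto
  moreover have "slash_vec \<phi> (- int K) (a, b) (\<tau>, z) = \<phi> (\<tau>, z)"
    using in_J_space \<tau> unfolding J_space_def by blast
  ultimately have "\<phi> (\<tau>, z) = inverse (?w ^ K) * \<phi> (\<tau>, z + \<omega>)"
    using psi_eq_minus_1[OF \<omega>] by (simp add: slash_vec_def Let_def power_int_minus)
  then show ?thesis
    by simp
qed

definition taylor :: "nat \<Rightarrow> complex \<Rightarrow> complex" where
  "taylor j \<tau> = (deriv ^^ j) (\<lambda>z. \<phi> (\<tau>, z)) 0"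

lemma eq_sigma_power:
  assumes \<tau>: "\<tau> \<in> upper_half_plane" and vanishing: "\<And>j. j < K \<Longrightarrow> taylor j \<tau> = 0"
  shows "\<phi> (\<tau>, z) = taylor K \<tau> / fact K * complex_lattice.sigma \<tau> 1 z ^ K"
proof -
  interpret complex_lattice \<tau> 1 by (rule complex_lattice_upper_half_plane[OF \<tau>])
  show ?thesis
    unfolding taylor_def
    using vanishing half_period_not_in_lattice
    by (intro quasi_periodic_eq_sigma_power entire quasi_periodic \<tau>) (simp_all add: taylor_def)
qed

lemma taylor_modular:
  assumes det: "a * d - b * c = 1" and \<tau>: "\<tau> \<in> upper_half_plane" and j: "j \<le> K"
  shows "taylor j (moebius a b c d \<tau>) * (of_int c * \<tau> + of_int d) ^ (K - j) = taylor j \<tau>"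
proof -
  let ?w = "of_int c * \<tau> + of_int d" and ?t = "moebius a b c d \<tau>"
  have w: "?w \<noteq> 0" by (rule moebius_denominator_nonzero[OF det \<tau>])
  have ent: "(\<lambda>z. \<phi> (?t, z)) holomorphic_on UNIV"
    by (rule entire[OF moebius_in_upper_half_plane[OF det \<tau>]])
  have comp: "(\<lambda>z. \<phi> (?t, inverse ?w * z)) holomorphic_on UNIV"
    by (rule holomorphic_on_compose_gen[of "\<lambda>z. inverse ?w * z" UNIV "\<lambda>z. \<phi> (?t, z)" UNIV, unfolded o_def])
       (auto intro!: holomorphic_intros ent)
  have "(\<lambda>z. \<phi> (\<tau>, z)) = (\<lambda>z. ?w ^ K * \<phi> (?t, inverse ?w * z))"
    using modular[OF det \<tau>] by (simp add: divide_inverse mult.commute)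
  then have "taylor j \<tau> = (deriv ^^ j) (\<lambda>z. ?w ^ K * \<phi> (?t, inverse ?w * z)) 0"
    unfolding taylor_def by (rule arg_cong)
  also have "\<dots> = ?w ^ K * (deriv ^^ j) (\<lambda>z. \<phi> (?t, inverse ?w * z)) 0"
    by (rule higher_deriv_cmult[OF comp]) auto
  also have "(deriv ^^ j) (\<lambda>z. \<phi> (?t, inverse ?w * z)) 0 = inverse ?w ^ j * taylor j ?t"
    unfolding taylor_def using higher_deriv_compose_linear[OF ent, of UNIV 0 "inverse ?w" j] by simp
  also have "?w ^ K * (inverse ?w ^ j * taylor j ?t) = ?w ^ (K - j) * (?w ^ j * inverse ?w ^ j) * taylor j ?t"
    using j by (simp add: power_add[symmetric])
  also have "?w ^ j * inverse ?w ^ j = 1" using w by (simp add: power_inverse)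
  finally show ?thesis by simp
qed

lemma normalized_q_expansion:
  obtains P :: "nat \<Rightarrow> complex \<Rightarrow> complex" where "\<And>n. P n holomorphic_on UNIV"
    "\<And>\<tau> z. \<tau> \<in> upper_half_plane \<Longrightarrow> (\<lambda>n. P n z * e \<tau> ^ n) sums (rho \<tau> z powi (- int K) * \<phi> (\<tau>, z))"
proof -
  have "mat 1 \<in> SL2Z" by (simp add: SL2Z_def)
  then obtain r0 where "has_expansion (- int K) (slash_mat \<phi> (- int K) (mat 1)) r0"
    using in_J_space unfolding J_space_def by blast
  moreover have "slash_mat \<phi> (- int K) (mat 1) = \<phi>"
    by (simp add: slash_mat_def mat_def Let_def)
  ultimately obtain c where c: "\<And>\<tau> z. \<tau> \<in> upper_half_plane \<Longrightarrow>
      (\<lambda>n. \<Sum>r = - int (r0 n)..int (r0 n). c n r * e \<tau> ^ n * e z powi r) sums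
        (rho \<tau> z powi (- int K) * \<phi> (\<tau>, z))"
    unfolding has_expansion_def by auto
  define P where "P = (\<lambda>n z. \<Sum>r = - int (r0 n)..int (r0 n). c n r * e z powi r)"
  have "P n holomorphic_on UNIV" for n
    unfolding P_def by (intro holomorphic_intros) auto
  moreover have "(\<lambda>n. P n z * e \<tau> ^ n) sums (rho \<tau> z powi (- int K) * \<phi> (\<tau>, z))"
    if "\<tau> \<in> upper_half_plane" for \<tau> z
    using c[OF that, of z] by (simp add: P_def sum_distrib_left mult_ac)
  ultimately show ?thesis using that by blast
qed

text \<open>The quasi-period in \<open>\<rho>(\<tau>, z)\<close> is not evidently holomorphic, or even bounded, as a function of \<open>\<tau>\<close>.
  It cancels in \<open>\<rho>(\<tau>, z) \<rho>(\<tau>, \<i>z)\<close>, since \<open>z\<^sup>2 + (\<i>z)\<^sup>2 = 0\<close>.\<close>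

definition rotated_product :: "complex \<Rightarrow> complex \<Rightarrow> complex" where
  "rotated_product \<tau> z = e (of_nat K * (1 + \<i>) * z / 2) * \<phi> (\<tau>, z) * \<phi> (\<tau>, \<i> * z)"

lemma rotated_product_eq:
  "rotated_product \<tau> z =
    (rho \<tau> z powi (- int K) * \<phi> (\<tau>, z)) * (rho \<tau> (\<i> * z) powi (- int K) * \<phi> (\<tau>, \<i> * z))"
proof -
  have "rho \<tau> z * rho \<tau> (\<i> * z) = exp (- (of_real pi * \<i> * (1 + \<i>) * z))"
    unfolding rho_def exp_add[symmetric]
    by (rule arg_cong[of _ _ exp]) (simp add: power2_eq_square algebra_simps)
  then have "(rho \<tau> z * rho \<tau> (\<i> * z)) powi (- int K) = exp (of_nat K * (of_real pi * \<i> * (1 + \<i>) * z))"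
    by (simp add: power_int_minus exp_minus exp_of_nat_mult power_inverse)
  also have "\<dots> = e (of_nat K * (1 + \<i>) * z / 2)"
    unfolding e_def by (rule arg_cong[of _ _ exp]) simp
  finally show ?thesis
    by (simp add: rotated_product_def power_int_mult_distrib mult_ac)
qed

lemma rotated_product_q_expansion:
  obtains Q :: "nat \<Rightarrow> complex \<Rightarrow> complex" where "\<And>n. Q n holomorphic_on UNIV"
    "\<And>\<tau> z. \<tau> \<in> upper_half_plane \<Longrightarrow> (\<lambda>n. Q n z * e \<tau> ^ n) sums rotated_product \<tau> z"
proof -
  obtain P :: "nat \<Rightarrow> complex \<Rightarrow> complex" where P: "\<And>n. P n holomorphic_on UNIV"
    and sums: "\<And>\<tau> z. \<tau> \<in> upper_half_plane \<Longrightarrow> (\<lambda>n. P n z * e \<tau> ^ n) sums (rho \<tau> z powi (- int K) * \<phi> (\<tau>, z))"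
    using normalized_q_expansion by metis
  define Q where "Q = (\<lambda>n z. \<Sum>i\<le>n. P i z * P (n - i) (\<i> * z))"
  have "(\<lambda>z. P n (\<i> * z)) holomorphic_on UNIV" for n
    by (rule holomorphic_on_compose_gen[of "\<lambda>z. \<i> * z" UNIV "P n" UNIV, unfolded o_def])
       (auto intro!: holomorphic_intros P)
  then have "Q n holomorphic_on UNIV" for n
    unfolding Q_def by (intro holomorphic_intros P)
  moreover have "(\<lambda>n. Q n z * e \<tau> ^ n) sums rotated_product \<tau> z" if \<tau>: "\<tau> \<in> upper_half_plane" for \<tau> z
  proof -
    have "summable (\<lambda>n. norm (P n z * e \<tau> ^ n))" for z
      using sums by (intro q_series_abs_summable \<tau>) (auto intro: sums_summable)
    then have "(\<lambda>n. \<Sum>i\<le>n. (P i z * e \<tau> ^ i) * (P (n - i) (\<i> * z) * e \<tau> ^ (n - i))) sums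
        ((\<Sum>n. P n z * e \<tau> ^ n) * (\<Sum>n. P n (\<i> * z) * e \<tau> ^ n))"
      by (intro Cauchy_product_sums)
    also have "(\<Sum>n. P n z * e \<tau> ^ n) * (\<Sum>n. P n (\<i> * z) * e \<tau> ^ n) = rotated_product \<tau> z"
      unfolding rotated_product_eq sums_unique[OF sums[OF \<tau>], symmetric] ..
    also have "(\<lambda>n. \<Sum>i\<le>n. (P i z * e \<tau> ^ i) * (P (n - i) (\<i> * z) * e \<tau> ^ (n - i))) = (\<lambda>n. Q n z * e \<tau> ^ n)"
      unfolding Q_def sum_distrib_right
      by (intro ext sum.cong refl) (simp add: mult_ac power_add[symmetric])
    finally show ?thesis .
  qed
  ultimately show ?thesis using that by blast
qed

lemma rotated_product_bounded:
  assumes y: "y > 0"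
  shows "\<exists>M. \<forall>\<tau> z. Im \<tau> = y \<longrightarrow> \<bar>Re \<tau>\<bar> \<le> 1 \<longrightarrow> norm z \<le> 1 \<longrightarrow> norm (rotated_product \<tau> z) \<le> M"
proof -
  let ?Q = "(\<lambda>x. Complex x y) ` {-1..1} \<times> cball (0 :: complex) 1"
  have "compact ?Q"
    unfolding Complex_eq by (intro compact_Times compact_continuous_image continuous_intros) auto
  moreover have "continuous_on ?Q (\<lambda>p. rotated_product (fst p) (snd p))"
    unfolding rotated_product_def e_def using y
    by (intro continuous_intros continuous_on_compose2[OF continuous]) (auto simp: upper_half_plane_def)
  ultimately have "bounded ((\<lambda>p. rotated_product (fst p) (snd p)) ` ?Q)"
    by (intro compact_imp_bounded compact_continuous_image)
  then obtain M where M: "\<And>p. p \<in> ?Q \<Longrightarrow> norm (rotated_product (fst p) (snd p)) \<le> M"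
    unfolding bounded_iff by blast
  have "norm (rotated_product \<tau> z) \<le> M" if "Im \<tau> = y" "\<bar>Re \<tau>\<bar> \<le> 1" "norm z \<le> 1" for \<tau> z
  proof -
    have "\<tau> = Complex (Re \<tau>) y" using that by (simp add: complex_eq_iff)
    then have "(\<tau>, z) \<in> ?Q" using that by (auto simp: image_iff intro!: bexI[of _ "Re \<tau>"])
    from M[OF this] show ?thesis by simp
  qed
  then show ?thesis by blast
qed

lemma rotated_product_leading_coefficient:
  assumes \<tau>: "\<tau> \<in> upper_half_plane" and vanishing: "\<And>i. i < j \<Longrightarrow> taylor i \<tau> = 0"
  shows "(deriv ^^ (2 * j)) (rotated_product \<tau>) 0 = fact (2 * j) * \<i> ^ j * (taylor j \<tau> / fact j)\<^sup>2"
proof -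
  obtain f where f: "f holomorphic_on UNIV" "\<And>z. \<phi> (\<tau>, z) = z ^ j * f z"
    using entire_divide_power[OF entire[OF \<tau>], of j 0] vanishing by (auto simp: taylor_def)
  let ?g = "\<lambda>z. \<i> ^ j * e (of_nat K * (1 + \<i>) * z / 2) * f z * f (\<i> * z)"
  have "(\<lambda>z. f (\<i> * z)) holomorphic_on UNIV"
    by (rule holomorphic_on_compose_gen[of "\<lambda>z. \<i> * z" UNIV f UNIV, unfolded o_def])
       (auto intro!: holomorphic_intros f)
  then have "?g holomorphic_on UNIV"
    using f(1) by (intro holomorphic_intros) auto
  moreover have "rotated_product \<tau> = (\<lambda>z. z ^ (2 * j) * ?g z)"
    by (rule ext) (simp add: rotated_product_def f(2) power_mult_distrib mult_2_right power_add mult_ac)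
  ultimately have "(deriv ^^ (2 * j)) (rotated_product \<tau>) 0 = fact (2 * j) * ?g 0"
    using higher_deriv_power_mult[of ?g "2 * j" 0] by simp
  moreover have "taylor j \<tau> / fact j = f 0"
    using higher_deriv_power_mult[OF f(1), of j 0] by (simp add: taylor_def f(2))
  ultimately show ?thesis
    by (simp add: e_def power2_eq_square)
qed

lemma taylor_square_q_expansion:
  assumes vanishing: "\<And>i \<tau>. i < j \<Longrightarrow> \<tau> \<in> upper_half_plane \<Longrightarrow> taylor i \<tau> = 0"
  obtains g where "g holomorphic_on ball 0 1" "\<And>\<tau>. \<tau> \<in> upper_half_plane \<Longrightarrow> (taylor j \<tau>)\<^sup>2 = g (e \<tau>)"
proof -
  obtain Q :: "nat \<Rightarrow> complex \<Rightarrow> complex" where Q: "\<And>n. Q n holomorphic_on UNIV"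
    and sums: "\<And>\<tau> z. \<tau> \<in> upper_half_plane \<Longrightarrow> (\<lambda>n. Q n z * e \<tau> ^ n) sums rotated_product \<tau> z"
    using rotated_product_q_expansion by metis
  obtain h where h: "h holomorphic_on ball 0 1"
    "\<And>\<tau>. \<tau> \<in> upper_half_plane \<Longrightarrow> (deriv ^^ (2 * j)) (rotated_product \<tau>) 0 = h (e \<tau>)"
    using higher_deriv_q_expansion[OF Q sums rotated_product_bounded] by blast
  define g where "g = (\<lambda>w. (fact j)\<^sup>2 / (fact (2 * j) * \<i> ^ j) * h w)"
  have "g holomorphic_on ball 0 1"
    unfolding g_def using h(1) by (intro holomorphic_intros)
  moreover have "(taylor j \<tau>)\<^sup>2 = g (e \<tau>)" if "\<tau> \<in> upper_half_plane" for \<tau>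
    using rotated_product_leading_coefficient[OF that vanishing[OF _ that]] h(2)[OF that, symmetric]
    by (simp add: g_def power_divide)
  ultimately show ?thesis using that by blast
qed

lemma taylor_square_modular_form:
  assumes vanishing: "\<And>i \<tau>. i < j \<Longrightarrow> \<tau> \<in> upper_half_plane \<Longrightarrow> taylor i \<tau> = 0" and j: "j \<le> K"
  obtains g where "nonpos_weight_form (\<lambda>\<tau>. (taylor j \<tau>)\<^sup>2) g (2 * (K - j))"
proof -
  obtain g where g: "g holomorphic_on ball 0 1" "\<And>\<tau>. \<tau> \<in> upper_half_plane \<Longrightarrow> (taylor j \<tau>)\<^sup>2 = g (e \<tau>)"
    using taylor_square_q_expansion[OF vanishing] by metis
  have "(taylor j (moebius a b c d \<tau>))\<^sup>2 * (of_int c * \<tau> + of_int d) ^ (2 * (K - j)) = (taylor j \<tau>)\<^sup>2"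
    if "a * d - b * c = 1" "\<tau> \<in> upper_half_plane" for a b c d \<tau>
    using taylor_modular[OF that j] by (metis power_even_eq power_mult_distrib)
  then show ?thesis
    using g by (intro that[of g] nonpos_weight_form.intro) auto
qed

lemma taylor_eq_0: "j < K \<Longrightarrow> \<tau> \<in> upper_half_plane \<Longrightarrow> taylor j \<tau> = 0"
proof (induction j arbitrary: \<tau> rule: less_induct)
  case (less j)
  then have "taylor i \<tau> = 0" if "i < j" "\<tau> \<in> upper_half_plane" for i \<tau>
    using that by simp
  then obtain g where "nonpos_weight_form (\<lambda>\<tau>. (taylor j \<tau>)\<^sup>2) g (2 * (K - j))"
    using taylor_square_modular_form[of j] less.prems by auto
  from nonpos_weight_form.negative_weight_zero[OF this] less.prems show ?case by simp
qed

lemma taylor_K_square_constant: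
  assumes "\<tau> \<in> upper_half_plane" "\<tau>' \<in> upper_half_plane"
  shows "(taylor K \<tau>)\<^sup>2 = (taylor K \<tau>')\<^sup>2"
proof -
  obtain g where "nonpos_weight_form (\<lambda>\<tau>. (taylor K \<tau>)\<^sup>2) g (2 * (K - K))"
    using taylor_square_modular_form[of K] taylor_eq_0 by auto
  from nonpos_weight_form.weight_0_constant[OF this _ assms] show ?thesis by simp
qed

lemma eq_0_if_taylor_K_eq_0:
  assumes \<tau>: "\<tau> \<in> upper_half_plane" and zero: "taylor K \<tau> = 0"
  shows "\<phi> = 0"
proof -
  have "\<phi> (\<tau>', z) = 0" for \<tau>' z
  proof (cases "\<tau>' \<in> upper_half_plane")
    case True
    then have "taylor K \<tau>' = 0"
      using taylor_K_square_constant[OF True \<tau>] zero by simp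
    then show ?thesis
      using eq_sigma_power[OF True taylor_eq_0[OF _ True]] by simp
  next
    case False
    then show ?thesis using in_J_space by (auto simp: J_space_def)
  qed
  then show ?thesis by auto
qed

end

section \<open>The vector space of bounded Jacobi forms\<close>

lemma holomorphic2_on_add:
  assumes "holomorphic2_on f S" "holomorphic2_on g S"
  shows "holomorphic2_on (f + g) S"
  unfolding holomorphic2_on_def
proof
  fix p assume "p \<in> S"
  obtain a b where f: "(f has_derivative (\<lambda>h. a * fst h + b * snd h)) (at p within S)"
    using assms(1) \<open>p \<in> S\<close> unfolding holomorphic2_on_def by blast
  obtain a' b' where g: "(g has_derivative (\<lambda>h. a' * fst h + b' * snd h)) (at p within S)"
    using assms(2) \<open>p \<in> S\<close> unfolding holomorphic2_on_def by blast
  have "(f + g has_derivative (\<lambda>h. (a + a') * fst h + (b + b') * snd h)) (at p within S)"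
    unfolding plus_fun_def by (rule has_derivative_eq_rhs[OF has_derivative_add[OF f g]]) (simp add: algebra_simps)
  then show "\<exists>a b. (f + g has_derivative (\<lambda>h. a * fst h + b * snd h)) (at p within S)"
    by blast
qed

lemma holomorphic2_on_scale:
  assumes "holomorphic2_on f S"
  shows "holomorphic2_on (fun_scale x f) S"
  unfolding holomorphic2_on_def
proof
  fix p assume "p \<in> S"
  then obtain a b where f: "(f has_derivative (\<lambda>h. a * fst h + b * snd h)) (at p within S)"
    using assms unfolding holomorphic2_on_def by blast
  have "(fun_scale x f has_derivative (\<lambda>h. (x * a) * fst h + (x * b) * snd h)) (at p within S)"
    unfolding fun_scale_def
    by (rule has_derivative_eq_rhs[OF has_derivative_mult_right[OF f]]) (simp add: algebra_simps)
  then show "\<exists>a b. (fun_scale x f has_derivative (\<lambda>h. a * fst h + b * snd h)) (at p within S)"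
    by blast
qed

lemma slash_mat_add: "slash_mat (f + g) k M = slash_mat f k M + slash_mat g k M"
  by (auto simp: slash_mat_def Let_def fun_eq_iff algebra_simps)

lemma slash_mat_scale: "slash_mat (fun_scale x f) k M = fun_scale x (slash_mat f k M)"
  by (auto simp: slash_mat_def Let_def fun_eq_iff fun_scale_def)

lemma slash_vec_add: "slash_vec (f + g) k X = slash_vec f k X + slash_vec g k X"
  by (auto simp: slash_vec_def Let_def fun_eq_iff algebra_simps)

lemma slash_vec_scale: "slash_vec (fun_scale x f) k X = fun_scale x (slash_vec f k X)"
  by (auto simp: slash_vec_def Let_def fun_eq_iff fun_scale_def)

lemma has_expansion_mono:
  assumes "has_expansion k f r0" "\<And>n. r0 n \<le> r1 n"
  shows "has_expansion k f r1"
proof -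
  obtain c where c: "\<And>\<tau> z. \<tau> \<in> upper_half_plane \<Longrightarrow>
      (\<lambda>n. \<Sum>r = - int (r0 n)..int (r0 n). c n r * e \<tau> ^ n * e z powi r) sums (rho \<tau> z powi k * f (\<tau>, z))"
    using assms(1) unfolding has_expansion_def by blast
  define c' where "c' = (\<lambda>n r. if r \<in> {- int (r0 n)..int (r0 n)} then c n r else 0)"
  have "(\<Sum>r = - int (r1 n)..int (r1 n). c' n r * e \<tau> ^ n * e z powi r) =
      (\<Sum>r = - int (r0 n)..int (r0 n). c n r * e \<tau> ^ n * e z powi r)" for n \<tau> z
    by (rule sum.mono_neutral_cong_right) (use assms(2)[of n] in \<open>auto simp: c'_def\<close>)
  then show ?thesis
    unfolding has_expansion_def by (intro exI[of _ c']) (use c in simp)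
qed

lemma has_expansion_add:
  assumes "has_expansion k f r0" "has_expansion k g r1"
  shows "has_expansion k (f + g) (\<lambda>n. max (r0 n) (r1 n))"
proof -
  let ?r = "\<lambda>n. max (r0 n) (r1 n)"
  obtain c where c: "\<And>\<tau> z. \<tau> \<in> upper_half_plane \<Longrightarrow>
      (\<lambda>n. \<Sum>r = - int (?r n)..int (?r n). c n r * e \<tau> ^ n * e z powi r) sums (rho \<tau> z powi k * f (\<tau>, z))"
    using has_expansion_mono[OF assms(1), of ?r] unfolding has_expansion_def by auto
  obtain c' where c': "\<And>\<tau> z. \<tau> \<in> upper_half_plane \<Longrightarrow>
      (\<lambda>n. \<Sum>r = - int (?r n)..int (?r n). c' n r * e \<tau> ^ n * e z powi r) sums (rho \<tau> z powi k * g (\<tau>, z))"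
    using has_expansion_mono[OF assms(2), of ?r] unfolding has_expansion_def by auto
  have "(\<lambda>n. \<Sum>r = - int (?r n)..int (?r n). (c n r + c' n r) * e \<tau> ^ n * e z powi r) sums
      (rho \<tau> z powi k * (f + g) (\<tau>, z))" if "\<tau> \<in> upper_half_plane" for \<tau> z
    using sums_add[OF c[OF that, of z] c'[OF that, of z]]
    by (simp add: sum.distrib[symmetric] algebra_simps)
  then show ?thesis
    unfolding has_expansion_def by (intro exI[of _ "\<lambda>n r. c n r + c' n r"]) blast
qed

lemma has_expansion_scale:
  assumes "has_expansion k f r0"
  shows "has_expansion k (fun_scale x f) r0"
proof -
  obtain c where c: "\<And>\<tau> z. \<tau> \<in> upper_half_plane \<Longrightarrow>
      (\<lambda>n. \<Sum>r = - int (r0 n)..int (r0 n). c n r * e \<tau> ^ n * e z powi r) sums (rho \<tau> z powi k * f (\<tau>, z))"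
    using assms unfolding has_expansion_def by blast
  have "(\<lambda>n. \<Sum>r = - int (r0 n)..int (r0 n). (x * c n r) * e \<tau> ^ n * e z powi r) sums
      (rho \<tau> z powi k * fun_scale x f (\<tau>, z))" if "\<tau> \<in> upper_half_plane" for \<tau> z
    using sums_mult[OF c[OF that, of z], of x]
    by (simp add: sum_distrib_left fun_scale_def mult_ac)
  then show ?thesis
    unfolding has_expansion_def by (intro exI[of _ "\<lambda>n r. x * c n r"]) blast
qed

lemma admissible_max:
  assumes "admissible r0" "admissible r1"
  shows "admissible (\<lambda>n. max (r0 n) (r1 n))"
  unfolding admissible_def
proof
  show "incseq (\<lambda>n. max (r0 n) (r1 n))"
    using assms unfolding admissible_def incseq_def by (meson max.mono)
  have "(\<lambda>n. max (real (r0 n) / real n) (real (r1 n) / real n)) \<longlonglongrightarrow> max 0 0"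
    using assms unfolding admissible_def by (intro tendsto_max) auto
  moreover have "max (real (r0 n) / real n) (real (r1 n) / real n) = real (max (r0 n) (r1 n)) / real n" for n
    by (simp add: of_nat_max max_divide_distrib_right)
  ultimately show "(\<lambda>n. real (max (r0 n) (r1 n)) / real n) \<longlonglongrightarrow> 0" by simp
qed

lemma subspace_J_space: "cfun.subspace (J_space k)"
proof (rule cfun.subspaceI)
  have "has_expansion k 0 (\<lambda>_. 0)"
    unfolding has_expansion_def by (rule exI[of _ "\<lambda>_ _. 0"]) simp
  moreover have "slash_mat 0 k M = 0" "slash_vec 0 k X = 0" for M X
    by (auto simp: slash_mat_def slash_vec_def Let_def fun_eq_iff)
  moreover have "holomorphic2_on 0 S" for S
    unfolding holomorphic2_on_def zero_fun_def
    by (intro ballI exI[of _ 0]) (auto intro!: derivative_eq_intros)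
  moreover have "admissible (\<lambda>_. 0)" by (simp add: admissible_def)
  ultimately show "0 \<in> J_space k" unfolding J_space_def by auto
next
  fix f g assume fg: "f \<in> J_space k" "g \<in> J_space k"
  have "\<exists>r0. admissible r0 \<and> has_expansion k (slash_mat (f + g) k M) r0" if M: "M \<in> SL2Z" for M
  proof -
    obtain r0 r1 where "admissible r0" "has_expansion k (slash_mat f k M) r0"
      "admissible r1" "has_expansion k (slash_mat g k M) r1"
      using fg M unfolding J_space_def by blast
    then show ?thesis
      unfolding slash_mat_add by (blast intro: admissible_max has_expansion_add)
  qed
  with fg show "f + g \<in> J_space k"
    unfolding J_space_def by (simp add: slash_mat_add slash_vec_add holomorphic2_on_add)
next
  fix x :: complex and f :: "complex \<times> complex \<Rightarrow> complex" assume f: "f \<in> J_space k"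
  have "\<exists>r0. admissible r0 \<and> has_expansion k (slash_mat (fun_scale x f) k M) r0" if "M \<in> SL2Z" for M
    using f that unfolding J_space_def slash_mat_scale by (blast intro: has_expansion_scale)
  with f show "fun_scale x f \<in> J_space k"
    unfolding J_space_def
    by (simp add: slash_mat_scale slash_vec_scale holomorphic2_on_scale) (simp add: fun_scale_def)
qed

lemma INF_max_ge:
  assumes "admissible r0" "admissible r1"
  shows "(INF n. int n - int (max (r0 n) (r1 n))) \<ge> min (INF n. int n - int (r0 n)) (INF n. int n - int (r1 n))"
proof (rule cINF_greatest)
  fix n
  have "(INF n. int n - int (r n)) \<le> int n - int (r n)" if "admissible r" for r
    by (rule cINF_lower[OF admissible_INF_attained(1)[OF that]]) simp
  from this[OF assms(1)] this[OF assms(2)]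
  show "min (INF n. int n - int (r0 n)) (INF n. int n - int (r1 n)) \<le> int n - int (max (r0 n) (r1 n))"
    by (simp add: max_def min_def)
qed simp

lemma subspace_J_space_bounded: "cfun.subspace (J_space_bounded k m)"
proof (rule cfun.subspaceI)
  show "0 \<in> J_space_bounded k m"
    using cfun.subspace_0[OF subspace_J_space] by (simp add: J_space_bounded_def)
next
  fix f g assume fg: "f \<in> J_space_bounded k m" "g \<in> J_space_bounded k m"
  show "f + g \<in> J_space_bounded k m"
  proof (cases "f = 0 \<or> g = 0")
    case True
    then show ?thesis using fg by auto
  next
    case False
    obtain r0 where r0: "admissible r0" "has_expansion k f r0"
      "real_of_int (INF n. int n - int (r0 n)) + real_of_int k / 8 \<ge> - real_of_int m"
      using fg(1) False unfolding J_space_bounded_def by blast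
    obtain r1 where r1: "admissible r1" "has_expansion k g r1"
      "real_of_int (INF n. int n - int (r1 n)) + real_of_int k / 8 \<ge> - real_of_int m"
      using fg(2) False unfolding J_space_bounded_def by blast
    let ?r = "\<lambda>n. max (r0 n) (r1 n)"
    have "real_of_int (INF n. int n - int (?r n)) \<ge>
        real_of_int (min (INF n. int n - int (r0 n)) (INF n. int n - int (r1 n)))"
      unfolding of_int_le_iff by (rule INF_max_ge[OF r0(1) r1(1)])
    then have "real_of_int (INF n. int n - int (?r n)) + real_of_int k / 8 \<ge> - real_of_int m"
      using r0(3) r1(3) unfolding min_def by (auto split: if_splits)
    moreover have "f + g \<in> J_space k"
      using fg by (intro cfun.subspace_add[OF subspace_J_space]) (auto simp: J_space_bounded_def)
    ultimately show ?thesis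
      using admissible_max[OF r0(1) r1(1)] has_expansion_add[OF r0(2) r1(2)]
      unfolding J_space_bounded_def by blast
  qed
next
  fix x :: complex and f assume f: "f \<in> J_space_bounded k m"
  then have "fun_scale x f \<in> J_space k"
    by (intro cfun.subspace_scale[OF subspace_J_space]) (simp add: J_space_bounded_def)
  then show "fun_scale x f \<in> J_space_bounded k m"
    using f has_expansion_scale cfun.scale_zero_right unfolding J_space_bounded_def by blast
qed

lemma J_space_one_dimensional:
  assumes f: "f \<in> J_space (- int K)" "f \<noteq> 0" and g: "g \<in> J_space (- int K)"
  obtains x where "g = fun_scale x f"
proof -
  interpret f: jacobi_form f K by unfold_locales (rule f(1))
  interpret g: jacobi_form g K by unfold_locales (rule g)
  have i: "\<i> \<in> upper_half_plane" by (simp add: upper_half_plane_def)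
  have nonzero: "f.taylor K \<i> \<noteq> 0" using f.eq_0_if_taylor_K_eq_0[OF i] f(2) by blast
  define x where "x = g.taylor K \<i> / f.taylor K \<i>"
  define h where "h = g - fun_scale x f"
  interpret h: jacobi_form h K
    unfolding h_def using f(1) g
    by unfold_locales (intro cfun.subspace_diff[OF subspace_J_space] cfun.subspace_scale[OF subspace_J_space])
  have "h.taylor K \<i> = (deriv ^^ K) (\<lambda>z. g (\<i>, z) - x * f (\<i>, z)) 0"
    unfolding h.taylor_def by (simp add: h_def fun_scale_def)
  also have "\<dots> = g.taylor K \<i> - (deriv ^^ K) (\<lambda>z. x * f (\<i>, z)) 0"
    unfolding g.taylor_def
    by (rule higher_deriv_diff[of _ UNIV])
       (auto intro!: holomorphic_on_mult holomorphic_on_const g.entire[OF i] f.entire[OF i])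
  also have "(deriv ^^ K) (\<lambda>z. x * f (\<i>, z)) 0 = x * f.taylor K \<i>"
    unfolding f.taylor_def by (rule higher_deriv_cmult[OF f.entire[OF i, of UNIV]]) auto
  also have "g.taylor K \<i> - x * f.taylor K \<i> = 0"
    using nonzero by (simp add: x_def)
  finally have "h = 0"
    by (rule h.eq_0_if_taylor_K_eq_0[OF i])
  then show ?thesis
    using that[of x] by (simp add: h_def)
qed

lemma (in vector_space) one_dimensional_span_finite:
  assumes W: "subspace W" and multiple: "\<And>f g. f \<in> W \<Longrightarrow> f \<noteq> 0 \<Longrightarrow> g \<in> W \<Longrightarrow> \<exists>c. g = scale c f"
  shows "\<exists>B. finite B \<and> B \<subseteq> W \<and> span B = W"
proof (cases "W \<subseteq> {0}")
  case True
  then have "span {} = W"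
    using subspace_0[OF W] by auto
  then show ?thesis by blast
next
  case False
  then obtain f where f: "f \<in> W" "f \<noteq> 0" by blast
  have "W \<subseteq> span {f}"
    using multiple[OF f] by (auto simp: span_singleton)
  moreover have "span {f} \<subseteq> W"
    using f(1) by (intro span_minimal W) simp
  ultimately show ?thesis
    using f(1) by (intro exI[of _ "{f}"]) auto
qed

theorem theorem4p6:
  fixes k m :: int
  assumes "k < 0" and "m > 0"
  shows "cfun.subspace (J_space_bounded k m) \<and>
         (\<exists>B. finite B \<and> B \<subseteq> J_space_bounded k m \<and> cfun.span B = J_space_bounded k m)"
proof (intro conjI cfun.one_dimensional_span_finite subspace_J_space_bounded)
  obtain K where k: "k = - int K"
    using assms(1) by (metis int_cases2 of_nat_0_le_iff not_less)
  fix f g assume "f \<in> J_space_bounded k m" "f \<noteq> 0" "g \<in> J_space_bounded k m"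
  then show "\<exists>x. g = fun_scale x f"
    using J_space_one_dimensional[of f K g] by (auto simp: J_space_bounded_def k)
qed

end
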